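(* Let $M\subset\mathbb C^n$ be a smooth real hypersurface, let $B$ be a smooth complex subbundle of $T^{1,0}M$ of complex dimension $s$, and let $p\in M$. Let $f,g$ be germs of (complex-valued) smooth functions over $M$ at $p$. Then: (1) $\nu_B(fg)(p)=\nu_B(f)(p)+\nu_B(g)(p)$. (2) If $f,g$ are real-valued and $0\le f\le g$ with $g(p)=f(p)$, then $\nu_B(f)(p)\ge\nu_B(g)(p)$. (3) If $f\ge0$, then $\nu_B(f)(p)$ is an even number if not infinity.
   Context: Here $n\ge2$, $1\le s\le n-1$, and $T^{1,0}M$ is the bundle of $(1,0)$-vectors $\sum_j\xi_j\partial/\partial z_j$ of $\mathbb C^n$ tangent to $M$. Let $\Gamma_\infty(B)$ be the set of smooth sections of $B$, and let $\mathcal D_B$ be the module over real-valued smooth functions on $M$ generated by $\mathrm{Re}(L)$ and $\mathrm{Im}(L)$ for all $L\in\Gamma_\infty(B)$ (locally generated by $2s$ linearly independent real vector fields). For a germ $f$ of complex-valued smooth function on $M$ at $p$, $\nu_B(f)(p)\in\{0,1,2,\dots\}\cup\{\infty\}$ is the least $m$ such that $Y_m\cdots Y_1(f)(p)\ne0$ for some $Y_1,\dots,Y_m\in\mathcal D_B$ (for $m=0$ this means $f(p)\neq0$), and $\nu_B(f)(p)=\infty$ if no such $m$ exists. Equivalently, one may take the $Y_j$ in the module $\mathcal M_1(B)$ over complex-valued smooth functions generated by the sections of $B$ and their complex conjugates. The usual convention $a+\infty=\infty$ is used, and inequalities between germs hold near $p$. *)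

theory Defs
  imports "HOL-Analysis.Analysis" "HOL-Library.Extended_Nat"
begin

(* The real tangent space of C^n is identified with complex ^ 'n: the real vector
   sum_j (a_j d/dx_j + b_j d/dy_j) is the vector with components a_j + i b_j.
   The (1,0)-vector sum_j xi_j d/dz_j is represented by its coefficient vector xi. *)

(* C^k on open U; in finite dimension, checking each directional derivative suffices. *)
primrec Ck_on :: "nat \<Rightarrow> 'a set \<Rightarrow> ('a::euclidean_space \<Rightarrow> 'b::real_normed_vector) \<Rightarrow> bool" where
  "Ck_on 0 U f \<longleftrightarrow> continuous_on U f"
| "Ck_on (Suc k) U f \<longleftrightarrow> (\<forall>x\<in>U. f differentiable (at x)) \<and>
     (\<forall>v. Ck_on k U (\<lambda>x. frechet_derivative f (at x) v))"

definition smooth_on :: "'a set \<Rightarrow> ('a::euclidean_space \<Rightarrow> 'b::real_normed_vector) \<Rightarrow> bool" where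
  "smooth_on U f \<longleftrightarrow> (\<forall>k. Ck_on k U f)"

(* Smoothness on a (not necessarily open) set, used for relatively open pieces of M. *)
definition extends_smoothly_on ::
    "'a set \<Rightarrow> ('a::euclidean_space \<Rightarrow> 'b::real_normed_vector) \<Rightarrow> bool" where
  "extends_smoothly_on S f \<longleftrightarrow>
     (\<forall>z\<in>S. \<exists>U F. open U \<and> z \<in> U \<and> smooth_on U F \<and> (\<forall>w\<in>S \<inter> U. F w = f w))"

definition local_defining_function ::
    "(complex ^ 'n) set \<Rightarrow> (complex ^ 'n) set \<Rightarrow> (complex ^ 'n \<Rightarrow> real) \<Rightarrow> bool" where
  "local_defining_function M U r \<longleftrightarrow>
     open U \<and> smooth_on U r \<and> M \<inter> U = {z \<in> U. r z = 0} \<and>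
     (\<forall>z\<in>M \<inter> U. frechet_derivative r (at z) \<noteq> (\<lambda>v. 0))"

definition real_hypersurface :: "(complex ^ 'n) set \<Rightarrow> bool" where
  "real_hypersurface M \<longleftrightarrow> (\<forall>z\<in>M. \<exists>U r. z \<in> U \<and> local_defining_function M U r)"

(* d/dz_j = (d/dx_j - i d/dy_j) / 2 *)
definition wirtinger :: "(complex ^ 'n \<Rightarrow> complex) \<Rightarrow> complex ^ 'n \<Rightarrow> 'n \<Rightarrow> complex" where
  "wirtinger h z j =
     (frechet_derivative h (at z) (axis j 1) - \<i> * frechet_derivative h (at z) (axis j \<i>)) / 2"

(* (sum_j xi_j d/dz_j) h at z *)
definition apply10 :: "complex ^ 'n \<Rightarrow> (complex ^ 'n \<Rightarrow> complex) \<Rightarrow> complex ^ 'n \<Rightarrow> complex" where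
  "apply10 \<xi> h z = (\<Sum>j\<in>UNIV. \<xi> $ j * wirtinger h z j)"

definition T10 :: "(complex ^ 'n) set \<Rightarrow> complex ^ 'n \<Rightarrow> (complex ^ 'n) set" where
  "T10 M z = {\<xi>. \<forall>U r. local_defining_function M U r \<and> z \<in> U \<longrightarrow>
     apply10 \<xi> (\<lambda>w. complex_of_real (r w)) z = 0}"

definition smooth_subbundle ::
    "(complex ^ 'n) set \<Rightarrow> (complex ^ 'n \<Rightarrow> (complex ^ 'n) set) \<Rightarrow> nat \<Rightarrow> bool" where
  "smooth_subbundle M B s \<longleftrightarrow>
     (\<forall>z\<in>M. vec.subspace (B z) \<and> B z \<subseteq> T10 M z \<and> vec.dim (B z) = s) \<and>
     (\<forall>z\<in>M. \<exists>U (L :: nat \<Rightarrow> complex ^ 'n \<Rightarrow> complex ^ 'n). open U \<and> z \<in> U \<and>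
        (\<forall>i<s. extends_smoothly_on (M \<inter> U) (L i)) \<and>
        (\<forall>w\<in>M \<inter> U. B w = vec.span ((\<lambda>i. L i w) ` {..<s})))"

definition smooth_sections ::
    "(complex ^ 'n) set \<Rightarrow> (complex ^ 'n \<Rightarrow> (complex ^ 'n) set) \<Rightarrow> (complex ^ 'n \<Rightarrow> complex ^ 'n) set" where
  "smooth_sections M B = {L. extends_smoothly_on M L \<and> (\<forall>z\<in>M. L z \<in> B z)}"

(* Since d/dz_j = (d/dx_j - i d/dy_j) / 2, the real vector fields Re(L) and Im(L) of
   L = sum_j xi_j d/dz_j are xi / 2 and -i xi / 2 under the above identification;
   see re_field_apply and im_field_apply below. *)
definition re_field :: "(complex ^ 'n \<Rightarrow> complex ^ 'n) \<Rightarrow> complex ^ 'n \<Rightarrow> complex ^ 'n" where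
  "re_field L z = (1 / 2) *s L z"

definition im_field :: "(complex ^ 'n \<Rightarrow> complex ^ 'n) \<Rightarrow> complex ^ 'n \<Rightarrow> complex ^ 'n" where
  "im_field L z = (- \<i> / 2) *s L z"

lemma apply10_of_real:
  fixes r :: "complex ^ 'n \<Rightarrow> real"
  assumes "r differentiable (at z)"
  shows "apply10 \<xi> (\<lambda>w. complex_of_real (r w)) z =
    Complex (frechet_derivative r (at z) ((1 / 2) *s \<xi>)) (frechet_derivative r (at z) ((- \<i> / 2) *s \<xi>))"
proof -
  define D where "D = frechet_derivative r (at z)"
  have D: "(r has_derivative D) (at z)"
    using assms unfolding D_def by (simp add: frechet_derivative_works)
  then interpret D: bounded_linear D by (rule has_derivative_bounded_linear)
  have "((\<lambda>w. complex_of_real (r w)) has_derivative (\<lambda>v. complex_of_real (D v))) (at z)"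
    using D by (rule has_derivative_of_real)
  then have fd: "frechet_derivative (\<lambda>w. complex_of_real (r w)) (at z) = (\<lambda>v. complex_of_real (D v))"
    by (rule frechet_derivative_at[symmetric])
  have split: "c *s \<xi> = (\<Sum>j\<in>UNIV. Re (c * \<xi> $ j) *\<^sub>R axis j 1 + Im (c * \<xi> $ j) *\<^sub>R axis j \<i>)" for c
  proof (rule vec_eq_iff[THEN iffD2], rule allI)
    fix i
    have "(\<Sum>j\<in>UNIV. Re (c * \<xi> $ j) *\<^sub>R axis j 1 + Im (c * \<xi> $ j) *\<^sub>R axis j \<i>) $ i =
      (\<Sum>j\<in>UNIV. if j = i then Complex (Re (c * \<xi> $ j)) (Im (c * \<xi> $ j)) else 0)"
      unfolding sum_component
      by (rule sum.cong) (auto simp: axis_def complex_eq_iff)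
    then show "(c *s \<xi>) $ i = (\<Sum>j\<in>UNIV. Re (c * \<xi> $ j) *\<^sub>R axis j 1 + Im (c * \<xi> $ j) *\<^sub>R axis j \<i>) $ i"
      by (simp add: complex_eq_iff)
  qed
  have Ds: "D (c *s \<xi>) = (\<Sum>j\<in>UNIV. Re (c * \<xi> $ j) * D (axis j 1) + Im (c * \<xi> $ j) * D (axis j \<i>))" for c
    unfolding split[of c] by (simp add: D.sum D.add D.scaleR)
  show ?thesis
    unfolding apply10_def wirtinger_def fd D_def[symmetric] Ds
    by (simp add: complex_eq_iff sum_divide_distrib field_simps)
qed

lemma re_field_apply:
  assumes "r differentiable (at z)"
  shows "frechet_derivative r (at z) (re_field L z) = Re (apply10 (L z) (\<lambda>w. complex_of_real (r w)) z)"
  using apply10_of_real[OF assms] by (simp add: re_field_def)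

lemma im_field_apply:
  assumes "r differentiable (at z)"
  shows "frechet_derivative r (at z) (im_field L z) = Im (apply10 (L z) (\<lambda>w. complex_of_real (r w)) z)"
  using apply10_of_real[OF assms] by (simp add: im_field_def)

inductive_set D_module ::
    "(complex ^ 'n) set \<Rightarrow> (complex ^ 'n \<Rightarrow> (complex ^ 'n) set) \<Rightarrow> (complex ^ 'n \<Rightarrow> complex ^ 'n) set"
  for M :: "(complex ^ 'n) set" and B :: "complex ^ 'n \<Rightarrow> (complex ^ 'n) set" where
  D_re: "L \<in> smooth_sections M B \<Longrightarrow> re_field L \<in> D_module M B"
| D_im: "L \<in> smooth_sections M B \<Longrightarrow> im_field L \<in> D_module M B"
| D_add: "X \<in> D_module M B \<Longrightarrow> Y \<in> D_module M B \<Longrightarrow> (\<lambda>z. X z + Y z) \<in> D_module M B"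
| D_scale: "extends_smoothly_on M (\<phi> :: complex ^ 'n \<Rightarrow> real) \<Longrightarrow> X \<in> D_module M B \<Longrightarrow>
    (\<lambda>z. \<phi> z *\<^sub>R X z) \<in> D_module M B"

(* A derivative within M is unique only on vectors tangent to M; it is applied only to
   tangent vector fields, where it is the derivative of any smooth local extension of h. *)
definition apply_field ::
    "(complex ^ 'n) set \<Rightarrow> (complex ^ 'n \<Rightarrow> complex ^ 'n) \<Rightarrow> (complex ^ 'n \<Rightarrow> complex) \<Rightarrow> complex ^ 'n \<Rightarrow> complex" where
  "apply_field M Y h z = frechet_derivative h (at z within M) (Y z)"

(* Germs on M at p are given by representatives: total functions whose values matter only
   on M near p. *)
definition smooth_germ :: "(complex ^ 'n) set \<Rightarrow> complex ^ 'n \<Rightarrow> (complex ^ 'n \<Rightarrow> complex) \<Rightarrow> bool" where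
  "smooth_germ M p f \<longleftrightarrow> (\<exists>U. open U \<and> p \<in> U \<and> extends_smoothly_on (M \<inter> U) f)"

(* fold (apply_field M) [Y1, ..., Ym] f = Ym (... (Y1 f)) *)
definition nonvanishing_at ::
    "(complex ^ 'n) set \<Rightarrow> (complex ^ 'n \<Rightarrow> (complex ^ 'n) set) \<Rightarrow> (complex ^ 'n \<Rightarrow> complex) \<Rightarrow> complex ^ 'n \<Rightarrow> nat \<Rightarrow> bool" where
  "nonvanishing_at M B f p m \<longleftrightarrow>
     (\<exists>Ys. length Ys = m \<and> set Ys \<subseteq> D_module M B \<and> fold (apply_field M) Ys f p \<noteq> 0)"

definition nu ::
    "(complex ^ 'n) set \<Rightarrow> (complex ^ 'n \<Rightarrow> (complex ^ 'n) set) \<Rightarrow> (complex ^ 'n \<Rightarrow> complex) \<Rightarrow> complex ^ 'n \<Rightarrow> enat" where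
  "nu M B f p =
     (if \<exists>m. nonvanishing_at M B f p m then enat (LEAST m. nonvanishing_at M B f p m) else \<infinity>)"

end

theory Submission
  imports Defs
begin

text \<open>
  The order \<open>\<nu>\<^sub>B\<close> can be read off from the orders of vanishing along curves in \<open>M\<close>, and there the three
  claims are statements about limits of functions of one real variable.

  The curves are concatenations of flows. Given fields \<open>Z\<^sub>1, \<dots>, Z\<^sub>k\<close> in the module generated by \<open>B\<close> and real
  times \<open>t\<^sub>1, \<dots>, t\<^sub>k\<close>, let \<open>c(\<tau>)\<close> be the point reached from \<open>p\<close> by flowing along \<open>Z\<^sub>k\<close> for time \<open>t\<^sub>k \<tau>\<close>, then along
  \<open>Z\<^sub>k\<^sub>-\<^sub>1\<close> for time \<open>t\<^sub>k\<^sub>-\<^sub>1 \<tau>\<close>, and finally along \<open>Z\<^sub>1\<close> for time \<open>t\<^sub>1 \<tau>\<close>. The fields are tangent to \<open>M\<close>, so these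
  flows stay in \<open>M\<close> (\<open>tangent_field_flow\<close>). Repeated use of Taylor's formula gives, for each germ \<open>h\<close>,
  an expansion of \<open>h(c(\<tau>))\<close> in powers of \<open>\<tau>\<close> (\<open>probing_curve\<close>). Its coefficient of order \<open>j\<close> is a combination
  of words of length \<open>j\<close> in the fields applied to \<open>h\<close> at \<open>p\<close>, with the monomials of degree \<open>j\<close> in the times as
  factors.

  Two facts tie the coefficients to \<open>\<nu>\<^sub>B\<close>. Those of order below \<open>\<nu>\<^sub>B(h)(p)\<close> vanish, so for \<open>m \<le> \<nu>\<^sub>B(h)(p)\<close> the
  quotient \<open>h(c(\<tau>)) / \<tau>\<^sup>m\<close> tends to the coefficient of order \<open>m\<close> (\<open>probes_jets_limit_nu\<close>). And if
  \<open>m = \<nu>\<^sub>B(h)(p)\<close>, take as \<open>Z\<^sub>1, \<dots>, Z\<^sub>k\<close> the letters of a word that does not annihilate \<open>h\<close> at \<open>p\<close>: the coefficient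
  of order \<open>m\<close> is then a nonzero polynomial in the times, hence nonzero for generic times
  (\<open>exists_probing_curve_of_order_nu\<close>). Joining two words into one list of fields achieves this for two
  germs with the same curve.

  Multiplicativity follows by multiplying the limits for \<open>f\<close> and \<open>g\<close>, monotonicity by comparing them, and
  evenness by reversing the signs of all times, which multiplies the leading coefficient by \<open>(-1)\<^sup>m\<close>.

  Integral curves of a single field would not do. The module need not be closed under commutators: when
  \<open>\<nu>\<^sub>B(f)(p) = 2\<close> and the words of length two applied to \<open>f\<close> at \<open>p\<close> form an antisymmetric matrix, \<open>Y Y f\<close> vanishes
  at \<open>p\<close> for every \<open>Y\<close> in the module.
\<close>

section \<open>Closure properties of smooth functions\<close>

lemma Ck_on_subset: "Ck_on k U f \<Longrightarrow> V \<subseteq> U \<Longrightarrow> Ck_on k V f"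
  by (induction k arbitrary: f) (auto intro: continuous_on_subset)

lemma smooth_on_subset: "smooth_on U f \<Longrightarrow> V \<subseteq> U \<Longrightarrow> smooth_on V f"
  by (auto simp: smooth_on_def intro: Ck_on_subset)

lemma Ck_on_cong:
  assumes "open U" "Ck_on k U f" "\<And>x. x \<in> U \<Longrightarrow> f x = g x"
  shows "Ck_on k U g"
  using assms(2,3)
proof (induction k arbitrary: f g)
  case 0
  then show ?case using continuous_on_cong[of U U f g] by simp
next
  case (Suc k)
  have D: "(g has_derivative frechet_derivative f (at x)) (at x)" if "x \<in> U" for x
  proof -
    have "(f has_derivative frechet_derivative f (at x)) (at x)"
      using Suc.prems that by (simp add: frechet_derivative_works)
    then show ?thesis
      using has_derivative_transform_within_open assms(1) that Suc.prems(2) by blast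
  qed
  have eq: "frechet_derivative f (at x) = frechet_derivative g (at x)" if "x \<in> U" for x
    using frechet_derivative_at[OF D[OF that]] .
  have "Ck_on k U (\<lambda>x. frechet_derivative f (at x) v)" for v
    using Suc.prems(1) by simp
  then have "Ck_on k U (\<lambda>x. frechet_derivative g (at x) v)" for v
    by (rule Suc.IH) (simp add: eq)
  then show ?case using D by (auto simp: differentiable_def)
qed

text \<open>The derivative is given explicitly here: closure under an operation then follows by recursion, from
  its differentiation rule and its closure properties one order below.\<close>
lemma Ck_on_SucI:
  assumes "open U"
    and D: "\<And>x. x \<in> U \<Longrightarrow> (f has_derivative D x) (at x)"
    and "\<And>v. Ck_on k U (\<lambda>x. D x v)"
  shows "Ck_on (Suc k) U f"
proof -
  have "frechet_derivative f (at x) = D x" if "x \<in> U" for x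
    using frechet_derivative_at[OF D[OF that]] by simp
  then have "Ck_on k U (\<lambda>x. frechet_derivative f (at x) v)" for v
    using Ck_on_cong[OF assms(1) assms(3)[of v]] by simp
  then show ?thesis using D unfolding Ck_on.simps differentiable_def by blast
qed

lemma Ck_on_Suc_imp: "Ck_on (Suc k) U f \<Longrightarrow> Ck_on k U f"
proof (induction k arbitrary: f)
  case 0
  then have "f differentiable_on U"
    by (auto simp: differentiable_on_def intro: differentiable_at_withinI)
  then show ?case by (simp add: differentiable_imp_continuous_on)
next
  case (Suc k)
  then show ?case by (metis Ck_on.simps(2))
qed

lemma Ck_on_const: "open U \<Longrightarrow> Ck_on k U (\<lambda>x. c)"
  by (induction k arbitrary: c) (auto simp: frechet_derivative_const)

lemma Ck_on_add:
  assumes "open U" "Ck_on k U f" "Ck_on k U g"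
  shows "Ck_on k U (\<lambda>x. f x + g x)"
  using assms(2,3)
proof (induction k arbitrary: f g)
  case 0
  then show ?case by (simp add: continuous_on_add)
next
  case (Suc k)
  show ?case
    by (rule Ck_on_SucI[OF assms(1), where D = "\<lambda>x v. frechet_derivative f (at x) v + frechet_derivative g (at x) v"])
       (use Suc in \<open>auto intro!: has_derivative_add simp: frechet_derivative_works\<close>)
qed

text \<open>One Leibniz rule for every bilinear product: real and complex multiplication, scalar multiplication of
  fields, and the inner product.\<close>
lemma Ck_on_bilinear:
  assumes "bounded_bilinear pr" "open U" "Ck_on k U f" "Ck_on k U g"
  shows "Ck_on k U (\<lambda>x. pr (f x) (g x))"
  using assms(3,4)
proof (induction k arbitrary: f g)
  case 0
  then show ?case using bounded_bilinear.continuous_on[OF assms(1)] by simp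
next
  case (Suc k)
  have "Ck_on k U (\<lambda>x. pr (f x) (frechet_derivative g (at x) v) + pr (frechet_derivative f (at x) v) (g x))" for v
    using Suc.prems by (intro Ck_on_add[OF assms(2)] Suc.IH) (auto intro: Ck_on_Suc_imp)
  then show ?case
    using Suc.prems
    by (intro Ck_on_SucI[OF assms(2), where D = "\<lambda>x v. pr (f x) (frechet_derivative g (at x) v) + pr (frechet_derivative f (at x) v) (g x)"]
       bounded_bilinear.FDERIV[OF assms(1)]) (auto simp: frechet_derivative_works)
qed

lemma Ck_on_inverse:
  fixes u :: "'a::euclidean_space \<Rightarrow> real"
  assumes "open U" "Ck_on k U u" "\<And>x. x \<in> U \<Longrightarrow> u x \<noteq> 0"
  shows "Ck_on k U (\<lambda>x. inverse (u x))"
  using assms(2)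
proof (induction k)
  case 0
  then show ?case using assms(3) by (auto intro!: continuous_on_inverse)
next
  case (Suc k)
  then have i: "Ck_on k U (\<lambda>x. inverse (u x))" by (blast intro: Ck_on_Suc_imp)
  show ?case
  proof (rule Ck_on_SucI[OF assms(1)])
    fix x assume "x \<in> U"
    then show "((\<lambda>x. inverse (u x)) has_derivative (\<lambda>v. (-1) * (inverse (u x) * frechet_derivative u (at x) v * inverse (u x)))) (at x)"
      using Suc.prems assms(3) Deriv.has_derivative_inverse[of u x "frechet_derivative u (at x)" UNIV]
      by (simp add: frechet_derivative_works)
  next
    fix v
    show "Ck_on k U (\<lambda>x. (-1) * (inverse (u x) * frechet_derivative u (at x) v * inverse (u x)))"
      using Suc.prems i
      by (intro Ck_on_bilinear[OF bounded_bilinear_mult assms(1)] Ck_on_const[OF assms(1)]) auto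
  qed
qed

lemma smooth_on_cong: "open U \<Longrightarrow> smooth_on U f \<Longrightarrow> (\<And>x. x \<in> U \<Longrightarrow> f x = g x) \<Longrightarrow> smooth_on U g"
  unfolding smooth_on_def using Ck_on_cong by blast

lemma smooth_on_const: "open U \<Longrightarrow> smooth_on U (\<lambda>x. c)"
  by (simp add: smooth_on_def Ck_on_const)

lemma smooth_on_add: "open U \<Longrightarrow> smooth_on U f \<Longrightarrow> smooth_on U g \<Longrightarrow> smooth_on U (\<lambda>x. f x + g x)"
  by (simp add: smooth_on_def Ck_on_add)

lemma smooth_on_bilinear:
  "bounded_bilinear pr \<Longrightarrow> open U \<Longrightarrow> smooth_on U f \<Longrightarrow> smooth_on U g \<Longrightarrow> smooth_on U (\<lambda>x. pr (f x) (g x))"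
  by (simp add: smooth_on_def Ck_on_bilinear)

lemma smooth_on_sum:
  "open U \<Longrightarrow> (\<And>i. i \<in> I \<Longrightarrow> smooth_on U (f i)) \<Longrightarrow> smooth_on U (\<lambda>x. \<Sum>i\<in>I. f i x)"
  by (induction I rule: infinite_finite_induct) (auto intro: smooth_on_const smooth_on_add)

lemma smooth_on_inverse:
  fixes u :: "'a::euclidean_space \<Rightarrow> real"
  shows "open U \<Longrightarrow> smooth_on U u \<Longrightarrow> (\<And>x. x \<in> U \<Longrightarrow> u x \<noteq> 0) \<Longrightarrow> smooth_on U (\<lambda>x. inverse (u x))"
  by (simp add: smooth_on_def Ck_on_inverse)

lemma smooth_on_has_derivative:
  "smooth_on U f \<Longrightarrow> x \<in> U \<Longrightarrow> (f has_derivative frechet_derivative f (at x)) (at x)"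
  unfolding smooth_on_def by (metis Ck_on.simps(2) frechet_derivative_works)

lemma smooth_on_continuous: "smooth_on U f \<Longrightarrow> continuous_on U f"
  unfolding smooth_on_def by (metis Ck_on.simps(1))

lemma smooth_on_directional: "smooth_on U f \<Longrightarrow> smooth_on U (\<lambda>x. frechet_derivative f (at x) v)"
  unfolding smooth_on_def by (metis Ck_on.simps(2))

text \<open>Expanding the direction in an orthonormal basis leaves a sum of products of smooth functions.\<close>
lemma smooth_on_derivative_along:
  assumes "open U" "smooth_on U H" "smooth_on U X"
  shows "smooth_on U (\<lambda>x. frechet_derivative H (at x) (X x))"
proof (rule smooth_on_cong[OF assms(1)])
  show "smooth_on U (\<lambda>x. \<Sum>b\<in>Basis. (X x \<bullet> b) *\<^sub>R frechet_derivative H (at x) b)"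
    by (intro smooth_on_sum smooth_on_bilinear[OF bounded_bilinear_scaleR]
        smooth_on_bilinear[OF bounded_bilinear_inner] smooth_on_directional smooth_on_const assms)
  fix x assume "x \<in> U"
  then interpret bounded_linear "frechet_derivative H (at x)"
    using smooth_on_has_derivative[OF assms(2)] has_derivative_bounded_linear by blast
  have "frechet_derivative H (at x) (X x) = frechet_derivative H (at x) (\<Sum>b\<in>Basis. (X x \<bullet> b) *\<^sub>R b)"
    by (simp add: euclidean_representation)
  then show "(\<Sum>b\<in>Basis. (X x \<bullet> b) *\<^sub>R frechet_derivative H (at x) b) = frechet_derivative H (at x) (X x)"
    by (simp only: sum scaleR)
qed

text \<open>The partial derivatives are continuous, hence bounded on the compact ball, and they bound the operator
  norm of the derivative; the mean value inequality on the convex ball does the rest.\<close>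
lemma smooth_on_locally_lipschitz:
  fixes X :: "'a::euclidean_space \<Rightarrow> 'b::real_normed_vector"
  assumes "open U" "smooth_on U X" "cball p \<delta> \<subseteq> U"
  shows "\<exists>L. L-lipschitz_on (cball p \<delta>) X"
proof -
  define D where "D x = frechet_derivative X (at x)" for x
  have "\<exists>K. \<forall>x\<in>cball p \<delta>. norm (D x b) \<le> K" for b
  proof -
    have "compact ((\<lambda>x. D x b) ` cball p \<delta>)"
      unfolding D_def using smooth_on_directional[OF assms(2)] assms(3)
      by (intro compact_continuous_image smooth_on_continuous compact_cball) (rule smooth_on_subset)
    then show ?thesis using compact_imp_bounded bounded_iff by (metis imageI)
  qed
  then obtain K where K: "\<And>b x. x \<in> cball p \<delta> \<Longrightarrow> norm (D x b) \<le> K b" by metis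
  have "norm (D x v) \<le> (\<Sum>b\<in>Basis. \<bar>K b\<bar>) * norm v" if x: "x \<in> cball p \<delta>" for x v
  proof -
    interpret bounded_linear "D x"
      unfolding D_def using smooth_on_has_derivative[OF assms(2)] has_derivative_bounded_linear assms(3) x by blast
    have "D x v = D x (\<Sum>b\<in>Basis. (v \<bullet> b) *\<^sub>R b)" by (simp add: euclidean_representation)
    also have "\<dots> = (\<Sum>b\<in>Basis. (v \<bullet> b) *\<^sub>R D x b)" by (simp only: sum scaleR)
    also have "norm \<dots> \<le> (\<Sum>b\<in>Basis. \<bar>K b\<bar> * norm v)"
    proof (rule sum_norm_le)
      fix b :: 'a assume "b \<in> Basis"
      then have "\<bar>v \<bullet> b\<bar> \<le> norm v" by (rule Basis_le_norm)
      moreover have "norm (D x b) \<le> \<bar>K b\<bar>" using K[OF x, of b] by linarith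
      ultimately show "norm ((v \<bullet> b) *\<^sub>R D x b) \<le> \<bar>K b\<bar> * norm v"
        by (simp add: mult.commute mult_mono)
    qed
    finally show ?thesis by (simp add: sum_distrib_right)
  qed
  then have "onorm (D x) \<le> (\<Sum>b\<in>Basis. \<bar>K b\<bar>)" if "x \<in> cball p \<delta>" for x
    using that by (intro onorm_le) (auto simp: mult.commute)
  moreover have "(X has_derivative D x) (at x within cball p \<delta>)" if "x \<in> cball p \<delta>" for x
    unfolding D_def using that assms(3) smooth_on_has_derivative[OF assms(2)]
    by (blast intro: has_derivative_at_withinI)
  ultimately have "norm (X x - X y) \<le> (\<Sum>b\<in>Basis. \<bar>K b\<bar>) * norm (x - y)" if "x \<in> cball p \<delta>" "y \<in> cball p \<delta>" for x y
    using that by (intro differentiable_bound[where f' = D and S = "cball p \<delta>"]) auto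
  then show ?thesis
    by (intro exI[of _ "\<Sum>b\<in>Basis. \<bar>K b\<bar>"] lipschitz_onI) (auto simp: dist_norm sum_nonneg)
qed

section \<open>Integral curves of Lipschitz fields\<close>

text \<open>Picard iteration: the integral operator contracts the bounded continuous functions by the factor
  \<open>\<epsilon> * L\<close>. The length \<open>\<epsilon>\<close> of the time interval depends only on the field and not on the starting
  point \<open>x\<close>, which is what following several flows one after the other requires.\<close>
lemma lipschitz_ode_solution:
  fixes G :: "'a::euclidean_space \<Rightarrow> 'a"
  assumes L: "L-lipschitz_on UNIV G" and C: "\<And>y. norm (G y) \<le> C"
    and \<epsilon>: "0 \<le> \<epsilon>" "\<epsilon> * L < 1"
  shows "\<exists>u. u 0 = x \<and> (\<forall>t\<in>{0..\<epsilon>}. norm (u t - x) \<le> C * t \<and>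
           (u has_vector_derivative G (u t)) (at t within {0..\<epsilon>}))"
proof -
  \<comment> \<open>Clamping times to \<open>{0..\<epsilon>}\<close> makes the integral operator act on functions on the whole line.\<close>
  define cl where "cl t = max 0 (min \<epsilon> t)" for t
  have cl: "cl t \<in> {0..\<epsilon>}" for t using \<epsilon> by (auto simp: cl_def)
  define T where "T u t = x + integral {0..cl t} (\<lambda>s. G (u s))" for u t
  have contG: "continuous_on S G" for S
    using lipschitz_on_continuous_on[OF L] continuous_on_subset by blast
  have contGu: "continuous_on S (\<lambda>s. G (apply_bcontfun u s))" for u S
    by (rule continuous_on_compose2[OF contG[of UNIV]]) auto
  have bound: "norm (integral {0..t} (\<lambda>s. G (apply_bcontfun u s))) \<le> C * t" if "0 \<le> t" for u t
    using integral_bound[OF that contGu, of u C] C by simp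
  have C0: "0 \<le> C" using C[of 0] norm_ge_zero order_trans by blast
  have "T (apply_bcontfun u) \<in> bcontfun" for u
  proof (rule bcontfun_normI)
    have "continuous_on {0..\<epsilon>} (\<lambda>t. integral {0..t} (\<lambda>s. G (apply_bcontfun u s)))"
      by (intro indefinite_integral_continuous_1 integrable_continuous_real contGu)
    then have "continuous_on UNIV (\<lambda>t. integral {0..cl t} (\<lambda>s. G (apply_bcontfun u s)))"
      by (rule continuous_on_compose2) (use cl in \<open>auto simp: cl_def intro!: continuous_intros\<close>)
    then show "continuous_on UNIV (T (apply_bcontfun u))"
      unfolding T_def by (intro continuous_intros)
    fix t
    have "norm (T (apply_bcontfun u) t) \<le> norm x + C * cl t"
      unfolding T_def using bound[of "cl t" u] cl[of t] norm_triangle_le by fastforce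
    also have "\<dots> \<le> norm x + C * \<epsilon>" using cl[of t] C0 by (simp add: mult_left_mono)
    finally show "norm (T (apply_bcontfun u) t) \<le> norm x + C * \<epsilon>" .
  qed
  then have T: "apply_bcontfun (Bcontfun (T (apply_bcontfun u))) = T (apply_bcontfun u)" for u
    by (simp add: Bcontfun_inverse)
  have "\<exists>!u. Bcontfun (T (apply_bcontfun u)) = u"
  proof (rule banach_fix_type)
    show "0 \<le> \<epsilon> * L" using \<epsilon> lipschitz_on_nonneg[OF L] by simp
    show "\<epsilon> * L < 1" by fact
    show "\<forall>u v. dist (Bcontfun (T (apply_bcontfun u))) (Bcontfun (T (apply_bcontfun v))) \<le> \<epsilon> * L * dist u v"
    proof (intro allI dist_bound)
      fix u v :: "real \<Rightarrow>\<^sub>C 'a" and t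
      have "norm (integral {0..cl t} (\<lambda>s. G (u s) - G (v s))) \<le> (L * dist u v) * (cl t - 0)"
      proof (rule integral_bound)
        fix s
        have "norm (G (u s) - G (v s)) \<le> L * dist (u s) (v s)"
          using lipschitz_onD[OF L] by (simp add: dist_norm)
        also have "\<dots> \<le> L * dist u v"
          by (intro mult_left_mono dist_bounded lipschitz_on_nonneg[OF L])
        finally show "norm (G (u s) - G (v s)) \<le> L * dist u v" .
      qed (use cl[of t] in \<open>auto intro!: continuous_on_diff contGu\<close>)
      also have "\<dots> \<le> (L * dist u v) * \<epsilon>"
        using cl[of t] lipschitz_on_nonneg[OF L] by (intro mult_left_mono) auto
      finally show "dist (Bcontfun (T (apply_bcontfun u)) t) (Bcontfun (T (apply_bcontfun v)) t) \<le> \<epsilon> * L * dist u v"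
        by (simp add: T T_def dist_norm integral_diff integrable_continuous_real contGu mult_ac)
    qed
  qed
  then obtain u where "Bcontfun (T (apply_bcontfun u)) = u" by blast
  then have u: "apply_bcontfun u t = T (apply_bcontfun u) t" for t using T[of u] by simp
  have clt: "cl t = t" if "t \<in> {0..\<epsilon>}" for t using that by (auto simp: cl_def)
  show ?thesis
  proof (intro exI[of _ "apply_bcontfun u"] conjI ballI)
    show "apply_bcontfun u 0 = x" using \<epsilon> by (subst u) (simp add: T_def cl_def)
    fix t assume t: "t \<in> {0..\<epsilon>}"
    show "norm (apply_bcontfun u t - x) \<le> C * t"
      using bound[of t u] t by (subst u) (simp add: T_def clt)
    have "((\<lambda>t. x + integral {0..t} (\<lambda>s. G (apply_bcontfun u s))) has_vector_derivative 0 + G (apply_bcontfun u t)) (at t within {0..\<epsilon>})"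
      by (intro has_vector_derivative_add has_vector_derivative_const integral_has_vector_derivative contGu t)
    then have "((\<lambda>t. x + integral {0..t} (\<lambda>s. G (apply_bcontfun u s))) has_vector_derivative G (apply_bcontfun u t)) (at t within {0..\<epsilon>})" by simp
    then show "(apply_bcontfun u has_vector_derivative G (apply_bcontfun u t)) (at t within {0..\<epsilon>})"
      by (rule has_vector_derivative_transform[OF t, rotated]) (subst u, simp add: T_def clt)
  qed
qed

section \<open>Fields tangent to a hypersurface\<close>

lemma extends_smoothly_on_bilinear:
  assumes "bounded_bilinear pr" "extends_smoothly_on S f" "extends_smoothly_on S g"
  shows "extends_smoothly_on S (\<lambda>z. pr (f z) (g z))"
  unfolding extends_smoothly_on_def
proof
  fix z assume "z \<in> S"
  then obtain U F V G where "open U" "z \<in> U" "smooth_on U F" "\<forall>w\<in>S \<inter> U. F w = f w"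
      "open V" "z \<in> V" "smooth_on V G" "\<forall>w\<in>S \<inter> V. G w = g w"
    using assms(2,3) unfolding extends_smoothly_on_def by metis
  then show "\<exists>U F. open U \<and> z \<in> U \<and> smooth_on U F \<and> (\<forall>w\<in>S \<inter> U. F w = pr (f w) (g w))"
    by (intro exI[of _ "U \<inter> V"] exI[of _ "\<lambda>w. pr (F w) (G w)"])
       (auto intro!: smooth_on_bilinear[OF assms(1)] intro: smooth_on_subset)
qed

lemma extends_smoothly_on_add:
  assumes "extends_smoothly_on S f" "extends_smoothly_on S g"
  shows "extends_smoothly_on S (\<lambda>z. f z + g z)"
  unfolding extends_smoothly_on_def
proof
  fix z assume "z \<in> S"
  then obtain U F V G where "open U" "z \<in> U" "smooth_on U F" "\<forall>w\<in>S \<inter> U. F w = f w"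
      "open V" "z \<in> V" "smooth_on V G" "\<forall>w\<in>S \<inter> V. G w = g w"
    using assms unfolding extends_smoothly_on_def by metis
  then show "\<exists>U F. open U \<and> z \<in> U \<and> smooth_on U F \<and> (\<forall>w\<in>S \<inter> U. F w = f w + g w)"
    by (intro exI[of _ "U \<inter> V"] exI[of _ "\<lambda>w. F w + G w"])
       (auto intro!: smooth_on_add intro: smooth_on_subset)
qed

lemma extends_smoothly_on_const: "extends_smoothly_on S (\<lambda>z. c)"
  unfolding extends_smoothly_on_def using smooth_on_const[OF open_UNIV] by blast

lemma bounded_bilinear_vector_smult:
  "bounded_bilinear ((*s) :: complex \<Rightarrow> complex ^ 'n \<Rightarrow> complex ^ 'n)"
  unfolding bilinear_conv_bounded_bilinear[symmetric] bilinear_def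
  by (auto intro!: linearI simp: vec_eq_iff algebra_simps)

text \<open>The two properties of the fields in \<open>D_module\<close> from which integral curves inside the hypersurface arise.\<close>
definition tangent_field :: "(complex ^ 'n) set \<Rightarrow> (complex ^ 'n \<Rightarrow> complex ^ 'n) \<Rightarrow> bool" where
  "tangent_field M Y \<longleftrightarrow> extends_smoothly_on M Y \<and>
     (\<forall>z\<in>M. \<forall>U r. local_defining_function M U r \<and> z \<in> U \<longrightarrow> frechet_derivative r (at z) (Y z) = 0)"

lemma D_module_tangent_field:
  assumes "smooth_subbundle M B s" "Y \<in> D_module M B"
  shows "tangent_field M Y"
proof -
  have section_tangent: "apply10 (L z) (\<lambda>w. complex_of_real (r w)) z = 0" "r differentiable (at z)"
    if "L \<in> smooth_sections M B" "z \<in> M" "local_defining_function M U r" "z \<in> U" for L z U r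
  proof -
    show "apply10 (L z) (\<lambda>w. complex_of_real (r w)) z = 0"
      using that assms(1) unfolding smooth_sections_def smooth_subbundle_def T10_def by blast
    show "r differentiable (at z)"
      using that smooth_on_has_derivative unfolding local_defining_function_def differentiable_def by blast
  qed
  have linear_derivative: "linear (frechet_derivative r (at z))"
    if "local_defining_function M U r" "z \<in> U" for U r z
    using that smooth_on_has_derivative has_derivative_linear
    unfolding local_defining_function_def by blast
  show ?thesis
    using assms(2)
  proof induction
    case (D_re L)
    then have "frechet_derivative r (at z) (re_field L z) = 0"
      if "z \<in> M" "local_defining_function M U r" "z \<in> U" for z U r
      using section_tangent that by (simp add: re_field_apply)
    moreover have "extends_smoothly_on M (re_field L)"
      using D_re extends_smoothly_on_bilinear[OF bounded_bilinear_vector_smult extends_smoothly_on_const]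
      unfolding re_field_def smooth_sections_def by blast
    ultimately show ?case unfolding tangent_field_def by blast
  next
    case (D_im L)
    then have "frechet_derivative r (at z) (im_field L z) = 0"
      if "z \<in> M" "local_defining_function M U r" "z \<in> U" for z U r
      using section_tangent that by (simp add: im_field_apply)
    moreover have "extends_smoothly_on M (im_field L)"
      using D_im extends_smoothly_on_bilinear[OF bounded_bilinear_vector_smult extends_smoothly_on_const]
      unfolding im_field_def smooth_sections_def by blast
    ultimately show ?case unfolding tangent_field_def by blast
  next
    case (D_add X Y)
    show ?case
      using D_add linear_derivative unfolding tangent_field_def by (auto intro!: extends_smoothly_on_add simp: linear_add)
  next
    case (D_scale \<phi> X)
    show ?case
      using D_scale linear_derivative unfolding tangent_field_def
      by (auto intro!: extends_smoothly_on_bilinear[OF bounded_bilinear_scaleR] simp: linear_scale)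
  qed
qed

text \<open>A smooth extension of \<open>Y\<close> need not have integral curves that stay in \<open>M\<close>. Let \<open>F\<close> be such an extension and
  \<open>r\<close> a defining function, and fix a direction \<open>n\<close> in which \<open>r\<close> has nonzero derivative at \<open>p\<close>. Subtracting
  from \<open>F\<close> the multiple of \<open>n\<close> that makes it tangent to all level sets of \<open>r\<close> does not change it on \<open>M\<close>, where
  \<open>Y\<close> is tangent already. The integral curves of the corrected field keep \<open>r\<close> constant, so those that start
  in \<open>M\<close> remain in \<open>M\<close>. The constants are uniform in the starting point. The factor \<open>t\<close> covers backward
  flows, with forward time \<open>\<tau>\<close>.\<close>
lemma tangent_field_flow:
  fixes M :: "(complex ^ 'n) set" and t :: real
  assumes "real_hypersurface M" "tangent_field M Y" "p \<in> M"
  shows "\<exists>\<epsilon>>0. \<exists>\<delta>>0. \<exists>C. \<forall>x\<in>M \<inter> ball p \<delta>. \<exists>\<gamma>. \<gamma> 0 = x \<and>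
    (\<forall>\<tau>\<in>{0..\<epsilon>}. \<gamma> \<tau> \<in> M \<and> norm (\<gamma> \<tau> - x) \<le> C * \<tau> \<and>
       (\<gamma> has_vector_derivative t *\<^sub>R Y (\<gamma> \<tau>)) (at \<tau> within {0..\<epsilon>}))"
proof -
  obtain U r where p: "p \<in> U" and ldf: "local_defining_function M U r"
    using assms(1,3) unfolding real_hypersurface_def by blast
  then have U: "open U" "smooth_on U r" and MU: "M \<inter> U = {z \<in> U. r z = 0}"
    unfolding local_defining_function_def by auto
  obtain W F where W: "open W" "p \<in> W" "smooth_on W F" and F: "\<And>w. w \<in> M \<inter> W \<Longrightarrow> F w = Y w"
    using assms(2,3) unfolding tangent_field_def extends_smoothly_on_def by metis
  obtain n where n: "frechet_derivative r (at p) n \<noteq> 0"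
    using ldf p assms(3) unfolding local_defining_function_def by blast
  define q where "q x = frechet_derivative r (at x) n" for x
  define V where "V = U \<inter> W \<inter> {x \<in> U. q x \<noteq> 0}"
  have smooth_q: "smooth_on U q" unfolding q_def by (intro smooth_on_directional U)
  have "open {x \<in> U. q x \<noteq> 0}"
    using continuous_open_preimage[OF smooth_on_continuous[OF smooth_q] U(1), of "- {0}"]
    by (simp add: vimage_def Int_def open_Compl)
  then have "open V" unfolding V_def using U W by blast
  moreover have pV: "p \<in> V" using p W n by (simp add: V_def q_def)
  ultimately obtain \<delta> where \<delta>: "\<delta> > 0" "cball p \<delta> \<subseteq> V" using open_contains_cball by metis
  have V: "smooth_on V r" "smooth_on V F" "smooth_on V q"
    using U W smooth_q by (auto simp: V_def intro: smooth_on_subset)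
  define X where "X x = t *\<^sub>R (F x + (- 1 * (frechet_derivative r (at x) (F x) * inverse (q x))) *\<^sub>R n)" for x
  have smooth_X: "smooth_on V X"
    unfolding X_def
    by (intro smooth_on_bilinear[OF bounded_bilinear_scaleR] smooth_on_bilinear[OF bounded_bilinear_mult]
        smooth_on_add smooth_on_const smooth_on_derivative_along smooth_on_inverse V \<open>open V\<close>)
       (simp add: V_def)
  have drX: "frechet_derivative r (at x) (X x) = 0" if "x \<in> V" for x
  proof -
    interpret linear "frechet_derivative r (at x)"
      using smooth_on_has_derivative[OF V(1) that] by (rule has_derivative_linear)
    have "q x \<noteq> 0" using that by (simp add: V_def)
    then show ?thesis unfolding X_def by (simp add: scale add diff neg q_def[symmetric])
  qed
  have XY: "X x = t *\<^sub>R Y x" if "x \<in> M \<inter> V" for x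
  proof -
    have "F x = Y x" "frechet_derivative r (at x) (Y x) = 0"
      using that assms(2) ldf F unfolding tangent_field_def V_def by blast+
    then show ?thesis by (simp add: X_def)
  qed
  obtain L where L: "L-lipschitz_on (cball p \<delta>) X"
    using smooth_on_locally_lipschitz[OF \<open>open V\<close> smooth_X \<delta>(2)] by blast
  have "compact (X ` cball p \<delta>)"
    using smooth_X \<delta>(2) by (intro compact_continuous_image smooth_on_continuous compact_cball) (rule smooth_on_subset)
  then obtain C where C: "\<And>x. x \<in> cball p \<delta> \<Longrightarrow> norm (X x) \<le> C"
    using compact_imp_bounded bounded_iff by (metis imageI)
  \<comment> \<open>Composing with the projection onto the ball gives a bounded Lipschitz field on the whole space.\<close>
  define G where "G x = X (closest_point (cball p \<delta>) x)" for x
  have cp: "closest_point (cball p \<delta>) x \<in> cball p \<delta>" for x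
    using \<delta>(1) by (intro closest_point_in_set) auto
  have cpl: "dist (closest_point (cball p \<delta>) x) (closest_point (cball p \<delta>) y) \<le> dist x y" for x y
    using \<delta>(1) by (intro closest_point_lipschitz) auto
  have L0: "0 \<le> L" and C0: "0 \<le> C"
    using lipschitz_on_nonneg[OF L] order_trans[OF norm_ge_zero C[of p]] \<delta>(1) by auto
  have G: "L-lipschitz_on UNIV G" "\<And>x. norm (G x) \<le> C"
  proof -
    show "L-lipschitz_on UNIV G"
    proof (rule lipschitz_onI)
      fix x y
      have "dist (G x) (G y) \<le> L * dist (closest_point (cball p \<delta>) x) (closest_point (cball p \<delta>) y)"
        unfolding G_def by (rule lipschitz_onD[OF L cp cp])
      also have "\<dots> \<le> L * dist x y" by (rule mult_left_mono[OF cpl L0])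
      finally show "dist (G x) (G y) \<le> L * dist x y" .
    qed (rule L0)
    show "norm (G x) \<le> C" for x unfolding G_def by (rule C[OF cp])
  qed
  \<comment> \<open>The first bound keeps solutions that start in the half ball inside the ball, the second makes Picard iteration contract.\<close>
  define \<epsilon> where "\<epsilon> = min (\<delta> / (2 * (C + 1))) (1 / (2 * (L + 1)))"
  have \<epsilon>0: "0 < \<epsilon>" using \<delta> L0 C0 by (simp add: \<epsilon>_def)
  have "\<epsilon> * L \<le> 1 / (2 * (L + 1)) * L" using L0 by (intro mult_right_mono) (auto simp: \<epsilon>_def)
  also have "\<dots> < 1" using L0 by (simp add: field_simps)
  finally have \<epsilon>L: "\<epsilon> * L < 1" .
  have "C * \<epsilon> \<le> C * (\<delta> / (2 * (C + 1)))" using C0 by (intro mult_left_mono) (auto simp: \<epsilon>_def)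
  also have "\<dots> \<le> \<delta> / 2" using C0 \<delta> by (simp add: field_simps)
  finally have C\<epsilon>: "C * \<epsilon> \<le> \<delta> / 2" .
  have flow: "\<exists>\<gamma>. \<gamma> 0 = x \<and> (\<forall>\<tau>\<in>{0..\<epsilon>}. \<gamma> \<tau> \<in> M \<and> norm (\<gamma> \<tau> - x) \<le> C * \<tau> \<and>
       (\<gamma> has_vector_derivative t *\<^sub>R Y (\<gamma> \<tau>)) (at \<tau> within {0..\<epsilon>}))"
    if x: "x \<in> M \<inter> ball p (\<delta> / 2)" for x
  proof -
    obtain u where u0: "u 0 = x" and u: "\<And>\<tau>. \<tau> \<in> {0..\<epsilon>} \<Longrightarrow> norm (u \<tau> - x) \<le> C * \<tau>"
      "\<And>\<tau>. \<tau> \<in> {0..\<epsilon>} \<Longrightarrow> (u has_vector_derivative G (u \<tau>)) (at \<tau> within {0..\<epsilon>})"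
      using lipschitz_ode_solution[OF G less_imp_le[OF \<epsilon>0] \<epsilon>L, of x] by metis
    have ball: "u \<tau> \<in> cball p \<delta>" if "\<tau> \<in> {0..\<epsilon>}" for \<tau>
    proof -
      have "C * \<tau> \<le> C * \<epsilon>" using that C0 by (intro mult_left_mono) auto
      then have "norm (u \<tau> - x) \<le> \<delta> / 2" using u(1)[OF that] C\<epsilon> by linarith
      moreover have "dist p x < \<delta> / 2" using x by simp
      ultimately show ?thesis
        using dist_triangle[of p "u \<tau>" x] by (simp add: dist_norm norm_minus_commute)
    qed
    have uX: "(u has_vector_derivative X (u \<tau>)) (at \<tau> within {0..\<epsilon>})" if "\<tau> \<in> {0..\<epsilon>}" for \<tau>
      using u(2)[OF that] closest_point_self[OF ball[OF that]] by (simp add: G_def)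
    have "((\<lambda>\<tau>. r (u \<tau>)) has_vector_derivative 0) (at \<tau> within {0..\<epsilon>})" if "\<tau> \<in> {0..\<epsilon>}" for \<tau>
    proof -
      have uV: "u \<tau> \<in> V" using ball[OF that] \<delta>(2) by blast
      have "(r has_derivative frechet_derivative r (at (u \<tau>))) (at (u \<tau>) within u ` {0..\<epsilon>})"
        using smooth_on_has_derivative[OF V(1) uV] has_derivative_at_withinI by blast
      from vector_derivative_diff_chain_within[OF uX[OF that] this] show ?thesis
        using drX[OF uV] by (simp add: o_def)
    qed
    then obtain c where c: "\<And>\<tau>. \<tau> \<in> {0..\<epsilon>} \<Longrightarrow> r (u \<tau>) = c"
      using has_vector_derivative_zero_constant[of "{0..\<epsilon>}" "\<lambda>\<tau>. r (u \<tau>)"] by auto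
    have "x \<in> cball p \<delta>" using x \<delta>(1) by auto
    then have "r x = 0" using x MU \<delta>(2) unfolding V_def by blast
    then have r0: "r (u \<tau>) = 0" if "\<tau> \<in> {0..\<epsilon>}" for \<tau> using c[OF that] c[of 0] \<epsilon>0 u0 by simp
    have uM: "u \<tau> \<in> M \<inter> V" if "\<tau> \<in> {0..\<epsilon>}" for \<tau>
      using r0[OF that] ball[OF that] \<delta>(2) MU unfolding V_def by blast
    then show ?thesis
      using u0 u(1) uX XY by (intro exI[of _ u]) auto
  qed
  show ?thesis
    by (rule exI[of _ \<epsilon>], rule conjI[OF \<epsilon>0], rule exI[of _ "\<delta> / 2"], rule conjI,
        simp add: \<delta>, rule exI[of _ C], rule ballI, rule flow)
qed

section \<open>Derivatives of germs along tangent fields\<close>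

text \<open>A function on \<open>M\<close> has many derivatives within \<open>M\<close>, which may differ on vectors that are not tangent. On
  \<open>Y z\<close> they all agree: there each of them gives the derivative of \<open>h\<close> along an integral curve of \<open>Y\<close> in \<open>M\<close>.\<close>
lemma apply_field_eq:
  fixes h :: "complex ^ 'n \<Rightarrow> complex"
  assumes "real_hypersurface M" "tangent_field M Y" "z \<in> M" "(h has_derivative D) (at z within M)"
  shows "apply_field M Y h z = D (Y z)"
proof -
  obtain \<epsilon> \<delta> C where "\<epsilon> > 0" "\<delta> > 0" and ex: "\<forall>x\<in>M \<inter> ball z \<delta>. \<exists>\<gamma>. \<gamma> 0 = x \<and>
    (\<forall>\<tau>\<in>{0..\<epsilon>}. \<gamma> \<tau> \<in> M \<and> norm (\<gamma> \<tau> - x) \<le> C * \<tau> \<and>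
       (\<gamma> has_vector_derivative 1 *\<^sub>R Y (\<gamma> \<tau>)) (at \<tau> within {0..\<epsilon>}))"
    using tangent_field_flow[OF assms(1-3), of 1] by metis
  have "z \<in> M \<inter> ball z \<delta>" using assms(3) \<open>\<delta> > 0\<close> by simp
  from ex[rule_format, OF this]
  obtain \<gamma> where \<gamma>0: "\<gamma> 0 = z" and \<gamma>': "\<forall>\<tau>\<in>{0..\<epsilon>}. \<gamma> \<tau> \<in> M \<and> norm (\<gamma> \<tau> - z) \<le> C * \<tau> \<and>
       (\<gamma> has_vector_derivative 1 *\<^sub>R Y (\<gamma> \<tau>)) (at \<tau> within {0..\<epsilon>})" by blast
  have \<gamma>: "\<gamma> 0 = z" "\<And>\<tau>. \<tau> \<in> {0..\<epsilon>} \<Longrightarrow> \<gamma> \<tau> \<in> M"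
      "(\<gamma> has_vector_derivative Y z) (at 0 within {0..\<epsilon>})"
    using \<gamma>0 \<gamma>' \<gamma>'[rule_format, of 0] \<open>\<epsilon> > 0\<close> by auto
  have chain: "((h \<circ> \<gamma>) has_vector_derivative D' (Y z)) (at 0 within cbox 0 \<epsilon>)"
    if "(h has_derivative D') (at z within M)" for D'
  proof -
    have "(h has_derivative D') (at (\<gamma> 0) within \<gamma> ` {0..\<epsilon>})"
      unfolding \<gamma>(1) by (rule has_derivative_subset[OF that]) (use \<gamma>(2) in auto)
    then show ?thesis using vector_derivative_diff_chain_within[OF \<gamma>(3)] by simp
  qed
  have fd: "(h has_derivative frechet_derivative h (at z within M)) (at z within M)"
    using assms(4) frechet_derivative_works differentiable_def by blast
  show ?thesis
    unfolding apply_field_def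
    by (rule vector_derivative_unique_within_closed_interval[OF \<open>\<epsilon> > 0\<close> _ chain[OF fd] chain[OF assms(4)]])
       (use \<open>\<epsilon> > 0\<close> in simp)
qed

lemma smooth_germ_iff:
  assumes "p \<in> M"
  shows "smooth_germ M p f \<longleftrightarrow>
    (\<exists>U F. open U \<and> p \<in> U \<and> smooth_on U F \<and> (\<forall>w\<in>M \<inter> U. F w = f w))"
proof
  assume "smooth_germ M p f"
  then obtain U V F where "open U" "p \<in> U" "open V" "p \<in> V" "smooth_on V F"
      "\<forall>w\<in>M \<inter> U \<inter> V. F w = f w"
    using assms unfolding smooth_germ_def extends_smoothly_on_def by (metis IntI)
  then show "\<exists>U F. open U \<and> p \<in> U \<and> smooth_on U F \<and> (\<forall>w\<in>M \<inter> U. F w = f w)"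
    by (intro exI[of _ "U \<inter> V"] exI[of _ F]) (auto intro: smooth_on_subset)
next
  assume "\<exists>U F. open U \<and> p \<in> U \<and> smooth_on U F \<and> (\<forall>w\<in>M \<inter> U. F w = f w)"
  then show "smooth_germ M p f"
    unfolding smooth_germ_def extends_smoothly_on_def by blast
qed

lemma smooth_germ_mult:
  assumes "p \<in> M" "smooth_germ M p f" "smooth_germ M p g"
  shows "smooth_germ M p (\<lambda>z. f z * g z)"
proof -
  obtain U F where U: "open U" "p \<in> U" "smooth_on U F" "\<forall>w\<in>M \<inter> U. F w = f w"
    using assms(2)[unfolded smooth_germ_iff[OF assms(1)]] by blast
  obtain V G where V: "open V" "p \<in> V" "smooth_on V G" "\<forall>w\<in>M \<inter> V. G w = g w"
    using assms(3)[unfolded smooth_germ_iff[OF assms(1)]] by blast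
  have "smooth_on (U \<inter> V) (\<lambda>w. F w * G w)"
    using U V smooth_on_subset
    by (intro smooth_on_bilinear[OF bounded_bilinear_mult] open_Int) blast+
  moreover have "\<forall>w\<in>M \<inter> (U \<inter> V). F w * G w = f w * g w"
    using U V by simp
  moreover have "open (U \<inter> V)" "p \<in> U \<inter> V"
    using U V by auto
  ultimately show ?thesis
    unfolding smooth_germ_iff[OF assms(1)] by blast
qed

lemma has_derivative_within_extension:
  assumes "open U" "smooth_on U F" "\<forall>w\<in>M \<inter> U. F w = h w" "z \<in> M \<inter> U"
  shows "(h has_derivative frechet_derivative F (at z)) (at z within M)"
proof -
  have "(F has_derivative frechet_derivative F (at z)) (at z within M \<inter> U)"
    using smooth_on_has_derivative[OF assms(2)] assms(4) has_derivative_at_withinI by blast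
  then have "(h has_derivative frechet_derivative F (at z)) (at z within M \<inter> U)"
    by (rule has_derivative_transform[rotated 2]) (use assms in auto)
  moreover have "at z within M \<inter> U = at z within M"
    using assms by (intro at_within_nhd[of z U]) auto
  ultimately show ?thesis by simp
qed

lemma smooth_germ_apply_field:
  assumes "real_hypersurface M" "tangent_field M Y" "p \<in> M" "smooth_germ M p h"
  shows "smooth_germ M p (apply_field M Y h)"
proof -
  obtain U F where U: "open U" "p \<in> U" "smooth_on U F" "\<forall>w\<in>M \<inter> U. F w = h w"
    using assms(4)[unfolded smooth_germ_iff[OF assms(3)]] by blast
  obtain W X where W: "open W" "p \<in> W" "smooth_on W X" and X: "\<forall>w\<in>M \<inter> W. X w = Y w"
    using assms(2,3) unfolding tangent_field_def extends_smoothly_on_def by metis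
  have "smooth_on (U \<inter> W) (\<lambda>x. frechet_derivative F (at x) (X x))"
    using U W by (intro smooth_on_derivative_along) (auto intro: smooth_on_subset)
  moreover have "frechet_derivative F (at w) (X w) = apply_field M Y h w" if "w \<in> M \<inter> (U \<inter> W)" for w
    using apply_field_eq[OF assms(1,2) _ has_derivative_within_extension[OF U(1,3,4), of w]] that X by simp
  ultimately show ?thesis
    unfolding smooth_germ_iff[OF assms(3)] using U(1,2) W(1,2) by blast
qed

lemma smooth_germ_funpow_apply_field:
  assumes "real_hypersurface M" "tangent_field M Y" "p \<in> M" "smooth_germ M p h"
  shows "smooth_germ M p ((apply_field M Y ^^ i) h)"
  by (induction i) (use assms smooth_germ_apply_field in auto)

lemma smooth_germ_eventually_differentiable:
  assumes "p \<in> M" "smooth_germ M p h"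
  shows "\<forall>\<^sub>F z in nhds p. z \<in> M \<longrightarrow> h differentiable (at z within M)"
proof -
  obtain U F where U: "open U" "p \<in> U" "smooth_on U F" "\<forall>w\<in>M \<inter> U. F w = h w"
    using assms(2)[unfolded smooth_germ_iff[OF assms(1)]] by blast
  then have "\<forall>z\<in>U. z \<in> M \<longrightarrow> h differentiable (at z within M)"
    using has_derivative_within_extension[OF U(1,3,4)] unfolding differentiable_def by blast
  then show ?thesis using U(1,2) eventually_nhds by blast
qed

lemma smooth_germ_eventually_bounded:
  assumes "p \<in> M" "smooth_germ M p h"
  shows "\<exists>K. \<forall>\<^sub>F z in nhds p. z \<in> M \<longrightarrow> norm (h z) \<le> K"
proof -
  obtain U F where U: "open U" "p \<in> U" "smooth_on U F" "\<forall>w\<in>M \<inter> U. F w = h w"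
    using assms(2)[unfolded smooth_germ_iff[OF assms(1)]] by blast
  then have "isCont F p"
    using smooth_on_continuous continuous_on_eq_continuous_at by blast
  then have "((\<lambda>z. norm (F z)) \<longlongrightarrow> norm (F p)) (nhds p)"
    unfolding isCont_def tendsto_at_iff_tendsto_nhds by (rule tendsto_norm)
  then have "\<forall>\<^sub>F z in nhds p. norm (F z) < norm (F p) + 1"
    by (rule order_tendstoD) simp
  moreover have "\<forall>\<^sub>F z in nhds p. z \<in> U" using U by (simp add: eventually_nhds_in_open)
  ultimately have "\<forall>\<^sub>F z in nhds p. z \<in> M \<longrightarrow> norm (h z) \<le> norm (F p) + 1"
    by eventually_elim (use U in fastforce)
  then show ?thesis by blast
qed

text \<open>Along an integral curve of \<open>t Y\<close> in \<open>M\<close> the \<open>i\<close>-th derivative of \<open>h\<close> is \<open>t\<^sup>i Y\<^sup>i h\<close>, so this is Taylor's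
  formula. The remainder is bounded uniformly over all integral curves that start near \<open>p\<close>, because
  \<open>Y\<^sup>m\<^sup>+\<^sup>1 h\<close> is bounded on \<open>M\<close> near \<open>p\<close>.\<close>
lemma flow_taylor:
  assumes hyp: "real_hypersurface M" "tangent_field M Y" "p \<in> M" "smooth_germ M p h"
  shows "\<exists>K. \<exists>\<eta>>0. \<forall>\<gamma> \<tau>. \<gamma> 0 \<in> M \<inter> ball p \<eta> \<longrightarrow> 0 \<le> \<tau> \<longrightarrow> \<tau> < \<eta> \<longrightarrow>
    (\<forall>s\<in>{0..\<tau>}. \<gamma> s \<in> M \<and> norm (\<gamma> s - \<gamma> 0) \<le> C * s \<and>
       (\<gamma> has_vector_derivative t *\<^sub>R Y (\<gamma> s)) (at s within {0..\<tau>})) \<longrightarrow>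
    norm (h (\<gamma> \<tau>) - (\<Sum>i\<le>m. (\<tau> ^ i / fact i) *\<^sub>R t ^ i *\<^sub>R (apply_field M Y ^^ i) h (\<gamma> 0))) \<le> K * \<tau> ^ Suc m"
proof -
  define H where "H i = (apply_field M Y ^^ i) h" for i
  have H: "smooth_germ M p (H i)" for i
    unfolding H_def using smooth_germ_funpow_apply_field[OF hyp] .
  have "\<forall>\<^sub>F z in nhds p. \<forall>i\<in>{..m}. z \<in> M \<longrightarrow> H i differentiable (at z within M)"
    by (intro eventually_ball_finite ballI smooth_germ_eventually_differentiable hyp H) simp
  moreover obtain K where "\<forall>\<^sub>F z in nhds p. z \<in> M \<longrightarrow> norm (H (Suc m) z) \<le> K"
    using smooth_germ_eventually_bounded[OF hyp(3) H] by blast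
  ultimately have "\<forall>\<^sub>F z in nhds p. (\<forall>i\<in>{..m}. z \<in> M \<longrightarrow> H i differentiable (at z within M)) \<and>
      (z \<in> M \<longrightarrow> norm (H (Suc m) z) \<le> K)"
    by (rule eventually_conj)
  then obtain \<rho> where \<rho>: "\<rho> > 0"
      and diff: "\<And>z i. z \<in> M \<Longrightarrow> dist z p < \<rho> \<Longrightarrow> i \<le> m \<Longrightarrow> H i differentiable (at z within M)"
      and bound: "\<And>z. z \<in> M \<Longrightarrow> dist z p < \<rho> \<Longrightarrow> norm (H (Suc m) z) \<le> K"
    unfolding eventually_nhds_metric by blast
  \<comment> \<open>With this choice a curve that starts within \<open>\<eta>\<close> of \<open>p\<close> and moves by at most \<open>C * s\<close> up to time \<open>s\<close> stays within \<open>\<rho>\<close> until time \<open>\<eta>\<close>.\<close>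
  define \<eta> where "\<eta> = \<rho> / (1 + \<bar>C\<bar>)"
  have "0 < \<eta>" using \<rho> by (simp add: \<eta>_def)
  define K' where "K' = \<bar>t\<bar> ^ Suc m * \<bar>K\<bar>"
  show ?thesis
  proof (intro exI conjI allI impI)
    fix \<gamma> \<tau>
    assume \<gamma>0: "\<gamma> 0 \<in> M \<inter> ball p \<eta>" and \<tau>: "0 \<le> \<tau>" "\<tau> < \<eta>"
      and ass: "\<forall>s\<in>{0..\<tau>}. \<gamma> s \<in> M \<and> norm (\<gamma> s - \<gamma> 0) \<le> C * s \<and>
       (\<gamma> has_vector_derivative t *\<^sub>R Y (\<gamma> s)) (at s within {0..\<tau>})"
    have near: "\<gamma> s \<in> M" "dist (\<gamma> s) p < \<rho>" if s: "s \<in> {0..\<tau>}" for s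
    proof -
      show "\<gamma> s \<in> M" using ass s by blast
      have "norm (\<gamma> s - \<gamma> 0) \<le> C * s" using ass s by blast
      also have "\<dots> \<le> \<bar>C\<bar> * \<eta>" using s \<tau> by (intro mult_mono) auto
      finally have "dist (\<gamma> s) p < \<bar>C\<bar> * \<eta> + \<eta>"
        using \<gamma>0 dist_triangle[of "\<gamma> s" p "\<gamma> 0"] norm_minus_commute[of p "\<gamma> 0"]
        by (simp add: dist_norm)
      also have "\<dots> = (1 + \<bar>C\<bar>) * \<eta>" by (simp add: algebra_simps)
      also have "\<dots> = \<rho>" by (simp add: \<eta>_def)
      finally show "dist (\<gamma> s) p < \<rho>" .
    qed
    define Df where "Df i s = t ^ i *\<^sub>R H i (\<gamma> s)" for i s
    have D: "(Df i has_vector_derivative Df (Suc i) s) (at s within {0..\<tau>})"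
      if "i < Suc m" "0 \<le> s" "s \<le> \<tau>" for i s
    proof -
      have s: "s \<in> {0..\<tau>}" using that by simp
      have "H i differentiable (at (\<gamma> s) within M)" using diff near[OF s] that by simp
      then obtain D where D: "(H i has_derivative D) (at (\<gamma> s) within M)"
        unfolding differentiable_def by blast
      then have "(H i has_derivative D) (at (\<gamma> s) within \<gamma> ` {0..\<tau>})"
        by (rule has_derivative_subset) (use near in auto)
      then have "((H i \<circ> \<gamma>) has_vector_derivative D (t *\<^sub>R Y (\<gamma> s))) (at s within {0..\<tau>})"
        using ass s vector_derivative_diff_chain_within by blast
      moreover have "D (t *\<^sub>R Y (\<gamma> s)) = t *\<^sub>R H (Suc i) (\<gamma> s)"
        using apply_field_eq[OF hyp(1,2) near(1)[OF s] D] linear_scale[OF has_derivative_linear[OF D]]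
        by (simp add: H_def)
      ultimately have "((\<lambda>s. t ^ i *\<^sub>R (H i \<circ> \<gamma>) s) has_vector_derivative t ^ i *\<^sub>R t *\<^sub>R H (Suc i) (\<gamma> s)) (at s within {0..\<tau>})"
        using bounded_linear.has_vector_derivative[OF bounded_linear_scaleR_right] by metis
      then show ?thesis unfolding Df_def by (simp add: o_def mult.commute)
    qed
    define R where "R = (\<lambda>s. ((\<tau> - s) ^ (Suc m - 1) / fact (Suc m - 1)) *\<^sub>R Df (Suc m) s)"
    have "(R has_integral h (\<gamma> \<tau>) - (\<Sum>i<Suc m. ((\<tau> - 0) ^ i / fact i) *\<^sub>R Df i 0)) {0..\<tau>}"
      unfolding R_def
      by (rule Taylor_has_integral[of "Suc m" Df "\<lambda>s. h (\<gamma> s)" 0 \<tau>])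
         (use D \<tau> in \<open>auto simp: Df_def H_def\<close>)
    then have "norm (h (\<gamma> \<tau>) - (\<Sum>i<Suc m. ((\<tau> - 0) ^ i / fact i) *\<^sub>R Df i 0)) \<le> (\<tau> ^ m * K') * measure lborel {0..\<tau>}"
    proof (rule has_integral_bound_real[where S = "{}", rotated 2])
      fix s assume "s \<in> {0..\<tau>} - {}"
      then have s: "s \<in> {0..\<tau>}" by simp
      have "norm (Df (Suc m) s) \<le> K'"
        using bound[OF near[OF s]] unfolding Df_def K'_def norm_scaleR
        by (intro mult_mono) (auto simp: power_abs abs_mult)
      moreover have "(\<tau> - s) ^ m / fact m \<le> \<tau> ^ m / 1"
        using s by (intro frac_le power_mono) auto
      ultimately have "(\<tau> - s) ^ m / fact m * norm (Df (Suc m) s) \<le> \<tau> ^ m * K'"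
        using s \<tau> by (intro mult_mono) auto
      then show "norm (R s) \<le> \<tau> ^ m * K'"
        using s by (simp add: R_def)
    qed (use \<tau> in \<open>auto simp: K'_def\<close>)
    then show "norm (h (\<gamma> \<tau>) - (\<Sum>i\<le>m. (\<tau> ^ i / fact i) *\<^sub>R t ^ i *\<^sub>R (apply_field M Y ^^ i) h (\<gamma> 0))) \<le> K' * \<tau> ^ Suc m"
      using \<tau> by (simp add: lessThan_Suc_atMost Df_def H_def mult_ac)
  qed (rule \<open>0 < \<eta>\<close>)
qed

section \<open>Expansion along concatenated flows\<close>

text \<open>For times and fields \<open>(t\<^sub>1, Z\<^sub>1), \<dots>, (t\<^sub>k, Z\<^sub>k)\<close> the coefficient of order \<open>j\<close> is the sum over all multi-indices
  \<open>\<alpha>\<close> of size \<open>j\<close> of \<open>t\<^sup>\<alpha> / \<alpha>!\<close> times \<open>Z\<^sub>k\<^sup>\<alpha>\<^sup>k \<dots> Z\<^sub>1\<^sup>\<alpha>\<^sup>1 h\<close> at \<open>p\<close>. The recursion peels off one field at a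
  time, as the curves are built one flow at a time, and avoids multi-indices.\<close>
fun curve_coeff :: "(complex ^ 'n) set \<Rightarrow> complex ^ 'n \<Rightarrow> (real \<times> (complex ^ 'n \<Rightarrow> complex ^ 'n)) list
    \<Rightarrow> nat \<Rightarrow> (complex ^ 'n \<Rightarrow> complex) \<Rightarrow> complex" where
  "curve_coeff M p [] j h = (if j = 0 then h p else 0)"
| "curve_coeff M p ((t, Z) # ps) j h =
     (\<Sum>i\<le>j. (t ^ i / fact i) *\<^sub>R curve_coeff M p ps (j - i) ((apply_field M Z ^^ i) h))"

text \<open>The values of a germ along the curve expand in powers of the time, with the coefficients above. One
  curve serves all germs and all orders; this allows expansions of different germs to be compared.\<close>
definition probes_jets where
  "probes_jets M p ps c \<longleftrightarrow>
     (\<forall>\<^sub>F \<tau> in at_right 0. c \<tau> \<in> M) \<and> (c \<longlongrightarrow> p) (at_right (0::real)) \<and>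
     (\<forall>h m. smooth_germ M p h \<longrightarrow> (\<exists>K. \<forall>\<^sub>F \<tau> in at_right 0.
        norm (h (c \<tau>) - (\<Sum>j\<le>m. \<tau> ^ j *\<^sub>R curve_coeff M p ps j h)) \<le> K * \<tau> ^ Suc m))"

text \<open>The curve for \<open>(t, Z) # ps\<close> follows the curve for \<open>ps\<close> up to time \<open>\<tau>\<close> and then the flow of \<open>Z\<close> for time
  \<open>t \<tau>\<close>. Taylor's formula along the flow expresses \<open>h\<close> at the new point by the germs \<open>Z\<^sup>i h\<close> at the old one,
  whose expansions are known by induction; collecting powers of \<open>\<tau>\<close> gives the recursion for the
  coefficients. The old point moves with \<open>\<tau>\<close>, hence the uniformity in the flow lemmas.\<close>
lemma probing_curve:
  assumes M: "real_hypersurface M" and p: "p \<in> M" and "\<forall>Z\<in>snd ` set ps. tangent_field M Z"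
  shows "\<exists>c. probes_jets M p ps c"
  using assms(3)
proof (induction ps)
  case Nil
  have "(\<Sum>j\<le>m. \<tau> ^ j *\<^sub>R curve_coeff M p [] j h) = h p" for m h and \<tau> :: real
    by (simp add: if_distrib sum.delta cong: if_cong)
  then have "probes_jets M p [] (\<lambda>_. p)"
    unfolding probes_jets_def using p by (auto intro!: exI[of _ 0])
  then show ?case by blast
next
  case (Cons tZ ps)
  obtain t Z where tZ: "tZ = (t, Z)" by fastforce
  have Z: "tangent_field M Z" using Cons.prems tZ by simp
  obtain c where cM: "\<forall>\<^sub>F \<tau> in at_right 0. c \<tau> \<in> M" and cp: "(c \<longlongrightarrow> p) (at_right 0)"
    and exp: "\<And>h m. smooth_germ M p h \<Longrightarrow> \<exists>K. \<forall>\<^sub>F \<tau> in at_right 0.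
        norm (h (c \<tau>) - (\<Sum>j\<le>m. \<tau> ^ j *\<^sub>R curve_coeff M p ps j h)) \<le> K * \<tau> ^ Suc m"
    using Cons unfolding probes_jets_def by auto
  obtain \<epsilon> \<delta> C where \<epsilon>: "\<epsilon> > 0" and \<delta>: "\<delta> > 0" and ex: "\<forall>x\<in>M \<inter> ball p \<delta>. \<exists>\<gamma>. \<gamma> 0 = x \<and>
    (\<forall>\<tau>\<in>{0..\<epsilon>}. \<gamma> \<tau> \<in> M \<and> norm (\<gamma> \<tau> - x) \<le> C * \<tau> \<and>
       (\<gamma> has_vector_derivative t *\<^sub>R Z (\<gamma> \<tau>)) (at \<tau> within {0..\<epsilon>}))"
    using tangent_field_flow[OF M Z p, of t] by metis
  from bchoice[OF ex] obtain \<Gamma> where \<Gamma>: "\<And>x. x \<in> M \<inter> ball p \<delta> \<Longrightarrow> \<Gamma> x 0 = x \<and>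
    (\<forall>\<tau>\<in>{0..\<epsilon>}. \<Gamma> x \<tau> \<in> M \<and> norm (\<Gamma> x \<tau> - x) \<le> C * \<tau> \<and>
       (\<Gamma> x has_vector_derivative t *\<^sub>R Z (\<Gamma> x \<tau>)) (at \<tau> within {0..\<epsilon>}))" by blast
  define d where "d \<tau> = \<Gamma> (c \<tau>) \<tau>" for \<tau>
  have near: "\<forall>\<^sub>F \<tau> in at_right 0. c \<tau> \<in> M \<inter> ball p \<eta>" if "\<eta> > 0" for \<eta>
  proof -
    have "\<forall>\<^sub>F \<tau> in at_right 0. c \<tau> \<in> ball p \<eta>"
      using cp that by (intro topological_tendstoD) auto
    then show ?thesis using cM by eventually_elim auto
  qed
  have pos: "\<forall>\<^sub>F \<tau> in at_right 0. \<tau> \<in> {0<..<\<eta>}" if "\<eta> > 0" for \<eta> :: real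
    using that by (rule eventually_at_right_real)
  have dM: "\<forall>\<^sub>F \<tau> in at_right 0. d \<tau> \<in> M \<and> norm (d \<tau> - c \<tau>) \<le> C * \<tau>"
    using near[OF \<delta>] pos[OF \<epsilon>]
  proof eventually_elim
    case (elim \<tau>)
    then show ?case using \<Gamma>[OF elim(1)] by (auto simp: d_def)
  qed
  have "\<forall>\<^sub>F \<tau> in at_right 0. norm (d \<tau> - c \<tau>) \<le> C * \<tau>"
    using dM by eventually_elim blast
  moreover have "((\<lambda>\<tau>. C * \<tau>) \<longlongrightarrow> 0) (at_right 0)"
    by (auto intro!: tendsto_eq_intros)
  ultimately have "((\<lambda>\<tau>. d \<tau> - c \<tau>) \<longlongrightarrow> 0) (at_right 0)"
    by (rule Lim_null_comparison)
  from tendsto_add[OF this cp] have dp: "(d \<longlongrightarrow> p) (at_right 0)" by simp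
  have dexp: "\<exists>K. \<forall>\<^sub>F \<tau> in at_right 0.
        norm (h (d \<tau>) - (\<Sum>j\<le>m. \<tau> ^ j *\<^sub>R curve_coeff M p (tZ # ps) j h)) \<le> K * \<tau> ^ Suc m"
    if h: "smooth_germ M p h" for h m
  proof -
    define H where "H i = (apply_field M Z ^^ i) h" for i
    define a where "a i j = curve_coeff M p ps j (H i)" for i j
    from flow_taylor[OF M Z p h, of C t m, folded H_def]
    obtain K \<eta> where \<eta>: "\<eta> > 0" and K: "\<forall>\<gamma> \<tau>. \<gamma> 0 \<in> M \<inter> ball p \<eta> \<longrightarrow> 0 \<le> \<tau> \<longrightarrow> \<tau> < \<eta> \<longrightarrow>
      (\<forall>s\<in>{0..\<tau>}. \<gamma> s \<in> M \<and> norm (\<gamma> s - \<gamma> 0) \<le> C * s \<and>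
         (\<gamma> has_vector_derivative t *\<^sub>R Z (\<gamma> s)) (at s within {0..\<tau>})) \<longrightarrow>
      norm (h (\<gamma> \<tau>) - (\<Sum>i\<le>m. (\<tau> ^ i / fact i) *\<^sub>R t ^ i *\<^sub>R H i (\<gamma> 0))) \<le> K * \<tau> ^ Suc m"
      by (elim exE conjE)
    have "smooth_germ M p (H i)" for i
      unfolding H_def using smooth_germ_funpow_apply_field[OF M Z p h] .
    then have "\<exists>K. \<forall>\<^sub>F \<tau> in at_right 0.
        norm (H i (c \<tau>) - (\<Sum>j\<le>m - i. \<tau> ^ j *\<^sub>R a i j)) \<le> K * \<tau> ^ Suc (m - i)" for i
      unfolding a_def by (rule exp)
    then obtain L where L: "\<And>i. \<forall>\<^sub>F \<tau> in at_right 0.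
        norm (H i (c \<tau>) - (\<Sum>j\<le>m - i. \<tau> ^ j *\<^sub>R a i j)) \<le> L i * \<tau> ^ Suc (m - i)"
      using choice[of "\<lambda>i K. \<forall>\<^sub>F \<tau> in at_right 0.
        norm (H i (c \<tau>) - (\<Sum>j\<le>m - i. \<tau> ^ j *\<^sub>R a i j)) \<le> K * \<tau> ^ Suc (m - i)"] by blast
    have allL: "\<forall>\<^sub>F \<tau> in at_right 0. \<forall>i\<in>{..m}.
        norm (H i (c \<tau>) - (\<Sum>j\<le>m - i. \<tau> ^ j *\<^sub>R a i j)) \<le> L i * \<tau> ^ Suc (m - i)"
      by (intro eventually_ball_finite ballI L) simp
    have reindex: "(\<Sum>j\<le>m. \<tau> ^ j *\<^sub>R curve_coeff M p (tZ # ps) j h) =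
        (\<Sum>i\<le>m. (\<tau> ^ i / fact i) *\<^sub>R t ^ i *\<^sub>R (\<Sum>j\<le>m - i. \<tau> ^ j *\<^sub>R a i j))" for \<tau>
    proof -
      define g where "g i j = (\<tau> ^ (i + j) * t ^ i / fact i) *\<^sub>R a i j" for i j
      have "(\<Sum>j\<le>m. \<tau> ^ j *\<^sub>R curve_coeff M p (tZ # ps) j h) = (\<Sum>k\<le>m. \<Sum>i\<le>k. g i (k - i))"
        by (auto simp: tZ g_def a_def H_def scaleR_sum_right intro!: sum.cong)
      also have "\<dots> = (\<Sum>(i,j)\<in>{(i,j). i + j \<le> m}. g i j)"
        by (rule sum.triangle_reindex_eq[symmetric])
      also have "{(i,j). i + j \<le> m} = (SIGMA i:{..m}. {..m - i})" by auto
      also have "(\<Sum>(i,j)\<in>\<dots>. g i j) = (\<Sum>i\<le>m. \<Sum>j\<le>m - i. g i j)"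
        by (rule sum.Sigma[symmetric]) auto
      also have "\<dots> = (\<Sum>i\<le>m. (\<tau> ^ i / fact i) *\<^sub>R t ^ i *\<^sub>R (\<Sum>j\<le>m - i. \<tau> ^ j *\<^sub>R a i j))"
        by (auto simp: g_def scaleR_sum_right power_add mult_ac intro!: sum.cong)
      finally show ?thesis .
    qed
    define N where "N = K + (\<Sum>i\<le>m. \<bar>t\<bar> ^ i / fact i * L i)"
    have "\<forall>\<^sub>F \<tau> in at_right 0.
        norm (h (d \<tau>) - (\<Sum>j\<le>m. \<tau> ^ j *\<^sub>R curve_coeff M p (tZ # ps) j h)) \<le> N * \<tau> ^ Suc m"
      using near[OF \<delta>] near[OF \<eta>] pos[OF \<epsilon>] pos[OF \<eta>] allL
    proof eventually_elim
      case (elim \<tau>)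
      define \<gamma> where "\<gamma> = \<Gamma> (c \<tau>)"
      have \<gamma>0: "\<gamma> 0 = c \<tau>" and \<gamma>: "\<And>s. s \<in> {0..\<epsilon>} \<Longrightarrow> \<gamma> s \<in> M \<and> norm (\<gamma> s - c \<tau>) \<le> C * s \<and>
         (\<gamma> has_vector_derivative t *\<^sub>R Z (\<gamma> s)) (at s within {0..\<epsilon>})"
        using \<Gamma>[OF elim(1)] unfolding \<gamma>_def by auto
      have sub: "{0..\<tau>} \<subseteq> {0..\<epsilon>}" using elim by auto
      have "norm (h (\<gamma> \<tau>) - (\<Sum>i\<le>m. (\<tau> ^ i / fact i) *\<^sub>R t ^ i *\<^sub>R H i (\<gamma> 0))) \<le> K * \<tau> ^ Suc m"
      proof (rule K[THEN spec[of _ \<gamma>], THEN spec[of _ \<tau>], THEN mp, THEN mp, THEN mp, THEN mp])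
        show "\<forall>s\<in>{0..\<tau>}. \<gamma> s \<in> M \<and> norm (\<gamma> s - \<gamma> 0) \<le> C * s \<and>
         (\<gamma> has_vector_derivative t *\<^sub>R Z (\<gamma> s)) (at s within {0..\<tau>})"
          using \<gamma> sub unfolding \<gamma>0 by (meson has_vector_derivative_within_subset subsetD)
      qed (use elim \<gamma>0 in auto)
      then have 1: "norm (h (d \<tau>) - (\<Sum>i\<le>m. (\<tau> ^ i / fact i) *\<^sub>R t ^ i *\<^sub>R H i (c \<tau>))) \<le> K * \<tau> ^ Suc m"
        unfolding \<gamma>0 by (simp add: d_def \<gamma>_def)
      have "norm ((\<Sum>i\<le>m. (\<tau> ^ i / fact i) *\<^sub>R t ^ i *\<^sub>R H i (c \<tau>)) -
          (\<Sum>i\<le>m. (\<tau> ^ i / fact i) *\<^sub>R t ^ i *\<^sub>R (\<Sum>j\<le>m - i. \<tau> ^ j *\<^sub>R a i j))) =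
          norm (\<Sum>i\<le>m. (\<tau> ^ i / fact i) *\<^sub>R t ^ i *\<^sub>R (H i (c \<tau>) - (\<Sum>j\<le>m - i. \<tau> ^ j *\<^sub>R a i j)))"
        by (simp only: sum_subtractf[symmetric] scaleR_diff_right[symmetric])
      also have "\<dots> \<le> (\<Sum>i\<le>m. \<bar>t\<bar> ^ i / fact i * L i * \<tau> ^ Suc m)"
      proof (rule sum_norm_le)
        fix i assume i: "i \<in> {..m}"
        have "norm ((\<tau> ^ i / fact i) *\<^sub>R t ^ i *\<^sub>R (H i (c \<tau>) - (\<Sum>j\<le>m - i. \<tau> ^ j *\<^sub>R a i j))) =
            \<tau> ^ i / fact i * \<bar>t\<bar> ^ i * norm (H i (c \<tau>) - (\<Sum>j\<le>m - i. \<tau> ^ j *\<^sub>R a i j))"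
          using elim by (simp add: power_abs abs_mult)
        also have "\<dots> \<le> \<tau> ^ i / fact i * \<bar>t\<bar> ^ i * (L i * \<tau> ^ Suc (m - i))"
          using elim i by (intro mult_left_mono) auto
        also have "\<dots> = \<bar>t\<bar> ^ i / fact i * L i * (\<tau> ^ i * \<tau> ^ Suc (m - i))"
          by (simp add: mult_ac)
        also have "\<tau> ^ i * \<tau> ^ Suc (m - i) = \<tau> ^ Suc m"
          using i by (simp flip: power_add)
        finally show "norm ((\<tau> ^ i / fact i) *\<^sub>R t ^ i *\<^sub>R (H i (c \<tau>) - (\<Sum>j\<le>m - i. \<tau> ^ j *\<^sub>R a i j)))
            \<le> \<bar>t\<bar> ^ i / fact i * L i * \<tau> ^ Suc m" .
      qed
      finally have 2: "norm ((\<Sum>i\<le>m. (\<tau> ^ i / fact i) *\<^sub>R t ^ i *\<^sub>R H i (c \<tau>)) -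
          (\<Sum>j\<le>m. \<tau> ^ j *\<^sub>R curve_coeff M p (tZ # ps) j h)) \<le> (\<Sum>i\<le>m. \<bar>t\<bar> ^ i / fact i * L i * \<tau> ^ Suc m)"
        unfolding reindex .
      show ?case
        using norm_diff_triangle_le[OF 1 2] by (simp only: N_def distrib_right sum_distrib_right)
    qed
    then show ?thesis by blast
  qed
  have "\<forall>\<^sub>F \<tau> in at_right 0. d \<tau> \<in> M" using dM by eventually_elim blast
  then have "probes_jets M p (tZ # ps) d" unfolding probes_jets_def using dp dexp by blast
  then show ?case by blast
qed

section \<open>Generic times detect nonvanishing words\<close>

lemma fold_replicate_funpow: "fold F (replicate i Z) h = (F Z ^^ i) h"
  by (induction i arbitrary: h) (auto simp: funpow_swap1)

text \<open>The coefficient of order \<open>j\<close> is a linear combination of words of length \<open>j\<close> applied to \<open>h\<close>.\<close>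
lemma curve_coeff_eq_0:
  assumes "snd ` set ps \<subseteq> \<D>"
    and "\<And>Ys. length Ys = j \<Longrightarrow> set Ys \<subseteq> \<D> \<Longrightarrow> fold (apply_field M) Ys h p = 0"
  shows "curve_coeff M p ps j h = 0"
  using assms
proof (induction ps arbitrary: j h)
  case Nil
  then show ?case using Nil.prems(2)[of "[]"] by simp
next
  case (Cons tZ ps)
  obtain t Z where tZ: "tZ = (t, Z)" by fastforce
  have "curve_coeff M p ps (j - i) ((apply_field M Z ^^ i) h) = 0" if "i \<le> j" for i
  proof (rule Cons.IH)
    fix Ys assume Ys: "length Ys = j - i" "set Ys \<subseteq> \<D>"
    have "fold (apply_field M) (replicate i Z @ Ys) h p = 0"
      using Ys Cons.prems(1) that tZ by (intro Cons.prems(2)) (auto simp: set_replicate_conv_if)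
    then show "fold (apply_field M) Ys ((apply_field M Z ^^ i) h) p = 0"
      by (simp add: fold_replicate_funpow)
  qed (use Cons.prems(1) in auto)
  then show ?case by (simp add: tZ)
qed

text \<open>The coefficient of order \<open>j\<close> is homogeneous of degree \<open>j\<close> in the times.\<close>
lemma curve_coeff_reverse:
  "curve_coeff M p (map (\<lambda>(t, Z). (- t, Z)) ps) j h = (- 1) ^ j * curve_coeff M p ps j h"
proof (induction ps arbitrary: j h)
  case (Cons tZ ps)
  obtain t Z where tZ: "tZ = (t, Z)" by fastforce
  have "((- t) ^ i / fact i) *\<^sub>R ((- 1) ^ (j - i) * z) = (- 1) ^ j * ((t ^ i / fact i) *\<^sub>R z)"
    if "i \<le> j" for i and z :: complex
  proof -
    have "(- 1 :: complex) ^ i * (- 1) ^ (j - i) = (- 1) ^ j"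
      using that by (simp flip: power_add)
    then show ?thesis by (simp add: power_minus[of t] scaleR_conv_of_real mult_ac)
  qed
  then show ?case by (auto simp: tZ Cons.IH sum_distrib_left intro!: sum.cong)
qed simp

text \<open>As a polynomial in the times, \<open>curve_coeff\<close> of order \<open>m\<close> has a nonzero coefficient. The fields \<open>Zs\<close> are
  given and the times are still free.\<close>
fun jet_nonzero :: "(complex ^ 'n) set \<Rightarrow> complex ^ 'n \<Rightarrow> (complex ^ 'n \<Rightarrow> complex ^ 'n) list
    \<Rightarrow> nat \<Rightarrow> (complex ^ 'n \<Rightarrow> complex) \<Rightarrow> bool" where
  "jet_nonzero M p [] m h \<longleftrightarrow> m = 0 \<and> h p \<noteq> 0"
| "jet_nonzero M p (Z # Zs) m h \<longleftrightarrow> (\<exists>i\<le>m. jet_nonzero M p Zs (m - i) ((apply_field M Z ^^ i) h))"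

lemma jet_nonzero_append:
  assumes "jet_nonzero M p Zs m h"
  shows "jet_nonzero M p (Ys @ Zs) m h"
  using assms by (induction Ys) (auto intro!: exI[of _ 0])

text \<open>The exponents are \<open>1\<close> for each letter of the word \<open>Ys\<close> and \<open>0\<close> for each field in \<open>Zs\<close>. Together with the
  preceding lemma this lets two words share one list of fields, so that one curve detects both.\<close>
lemma jet_nonzero_word:
  assumes "fold (apply_field M) Ys h p \<noteq> 0"
  shows "jet_nonzero M p (Ys @ Zs) (length Ys) h"
  using assms
proof (induction Ys arbitrary: h)
  case Nil
  then have "h p \<noteq> 0" by simp
  then have "jet_nonzero M p Zs 0 h" by (induction Zs) auto
  then show ?case by simp
next
  case (Cons Y Ys)
  then have "jet_nonzero M p (Ys @ Zs) (length Ys) (apply_field M Y h)" by simp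
  then show ?case by (auto intro!: exI[of _ 1])
qed

lemma finite_real_roots:
  fixes d :: "nat \<Rightarrow> complex"
  assumes "i \<le> n" "d i \<noteq> 0"
  shows "finite {t :: real. (\<Sum>i\<le>n. (t ^ i / fact i) *\<^sub>R d i) = 0}"
proof -
  have "finite {z :: complex. (\<Sum>i\<le>n. (d i / fact i) * z ^ i) = 0}"
    unfolding polyfun_finite_roots using assms by (intro exI[of _ i]) auto
  then have "finite (complex_of_real -` {z. (\<Sum>i\<le>n. (d i / fact i) * z ^ i) = 0})"
    by (rule finite_vimageI) (rule inj_of_real)
  moreover have "complex_of_real -` {z. (\<Sum>i\<le>n. (d i / fact i) * z ^ i) = 0} =
      {t. (\<Sum>i\<le>n. (t ^ i / fact i) *\<^sub>R d i) = 0}"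
    by (auto simp: vimage_def scaleR_conv_of_real mult_ac)
  ultimately show ?thesis by simp
qed

text \<open>Two nonzero polynomials in the times have a common point where neither vanishes. The times are chosen
  from the last field to the first: with the later ones fixed, only finitely many values of the next time
  make one of the two coefficients vanish.\<close>
lemma exists_generic_times:
  assumes "jet_nonzero M p Zs a f" "jet_nonzero M p Zs b g"
  shows "\<exists>ps. map snd ps = Zs \<and> curve_coeff M p ps a f \<noteq> 0 \<and> curve_coeff M p ps b g \<noteq> 0"
  using assms
proof (induction Zs arbitrary: a b f g)
  case Nil
  then show ?case by simp
next
  case (Cons Z Zs)
  then obtain i k where i: "i \<le> a" "jet_nonzero M p Zs (a - i) ((apply_field M Z ^^ i) f)"
      and k: "k \<le> b" "jet_nonzero M p Zs (b - k) ((apply_field M Z ^^ k) g)" by auto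
  obtain ps where ps: "map snd ps = Zs" "curve_coeff M p ps (a - i) ((apply_field M Z ^^ i) f) \<noteq> 0"
      "curve_coeff M p ps (b - k) ((apply_field M Z ^^ k) g) \<noteq> 0"
    using Cons.IH[OF i(2) k(2)] by blast
  have "finite ({t. curve_coeff M p ((t, Z) # ps) a f = 0} \<union> {t. curve_coeff M p ((t, Z) # ps) b g = 0})"
    using finite_real_roots[OF i(1), of "\<lambda>i. curve_coeff M p ps (a - i) ((apply_field M Z ^^ i) f)"]
      finite_real_roots[OF k(1), of "\<lambda>i. curve_coeff M p ps (b - i) ((apply_field M Z ^^ i) g)"] ps
    by simp
  from ex_new_if_finite[OF infinite_UNIV_char_0 this] obtain t where
    "curve_coeff M p ((t, Z) # ps) a f \<noteq> 0" "curve_coeff M p ((t, Z) # ps) b g \<noteq> 0" by blast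
  then show ?case using ps(1) by (intro exI[of _ "(t, Z) # ps"]) simp
qed

section \<open>The order and its three properties\<close>

lemma probes_jets_limit:
  assumes "probes_jets M p ps c" "smooth_germ M p h" "\<And>j. j < m \<Longrightarrow> curve_coeff M p ps j h = 0"
  shows "((\<lambda>\<tau>. h (c \<tau>) /\<^sub>R \<tau> ^ m) \<longlongrightarrow> curve_coeff M p ps m h) (at_right 0)"
proof -
  obtain K where K: "\<forall>\<^sub>F \<tau> in at_right 0.
        norm (h (c \<tau>) - (\<Sum>j\<le>m. \<tau> ^ j *\<^sub>R curve_coeff M p ps j h)) \<le> K * \<tau> ^ Suc m"
    using assms(1,2) unfolding probes_jets_def by blast
  have sum: "(\<Sum>j\<le>m. \<tau> ^ j *\<^sub>R curve_coeff M p ps j h) = \<tau> ^ m *\<^sub>R curve_coeff M p ps m h" for \<tau>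
    using assms(3) by (simp add: lessThan_Suc_atMost[symmetric])
  have "\<forall>\<^sub>F \<tau> in at_right (0::real). 0 < \<tau>" by (rule eventually_at_right_less)
  with K have "\<forall>\<^sub>F \<tau> in at_right 0. norm (h (c \<tau>) /\<^sub>R \<tau> ^ m - curve_coeff M p ps m h) \<le> K * \<tau>"
  proof eventually_elim
    case (elim \<tau>)
    have "h (c \<tau>) /\<^sub>R \<tau> ^ m - curve_coeff M p ps m h =
        (h (c \<tau>) - \<tau> ^ m *\<^sub>R curve_coeff M p ps m h) /\<^sub>R \<tau> ^ m"
      using elim(2) by (simp add: scaleR_diff_right)
    also have "norm \<dots> = norm (h (c \<tau>) - \<tau> ^ m *\<^sub>R curve_coeff M p ps m h) / \<tau> ^ m"
      using elim(2) by (simp add: divide_inverse)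
    also have "\<dots> \<le> K * \<tau> ^ Suc m / \<tau> ^ m"
      using elim unfolding sum by (intro divide_right_mono) auto
    also have "\<dots> = K * \<tau>" using elim(2) by simp
    finally show ?case .
  qed
  moreover have "((\<lambda>\<tau>. K * \<tau>) \<longlongrightarrow> 0) (at_right 0)"
    by (auto intro!: tendsto_eq_intros)
  ultimately have "((\<lambda>\<tau>. h (c \<tau>) /\<^sub>R \<tau> ^ m - curve_coeff M p ps m h) \<longlongrightarrow> 0) (at_right 0)"
    by (rule Lim_null_comparison)
  then show ?thesis by (rule LIM_zero_cancel)
qed

lemma le_nu_iff: "enat k \<le> nu M B h p \<longleftrightarrow> (\<forall>j<k. \<not> nonvanishing_at M B h p j)"
proof (cases "\<exists>m. nonvanishing_at M B h p m")
  case True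
  define l where "l = (LEAST m. nonvanishing_at M B h p m)"
  have "nonvanishing_at M B h p l" "\<And>j. j < l \<Longrightarrow> \<not> nonvanishing_at M B h p j"
    unfolding l_def using LeastI_ex[OF True] not_less_Least by blast+
  then have "k \<le> l \<longleftrightarrow> (\<forall>j<k. \<not> nonvanishing_at M B h p j)"
    by (meson leI less_le_trans)
  then show ?thesis using True by (simp add: nu_def l_def)
qed (auto simp: nu_def)

lemma nu_eq_imp_nonvanishing: "nu M B h p = enat k \<Longrightarrow> nonvanishing_at M B h p k"
  unfolding nu_def by (auto split: if_splits intro: LeastI)

lemma curve_coeff_below_nu:
  assumes "snd ` set ps \<subseteq> D_module M B" "enat m \<le> nu M B h p" "j < m"
  shows "curve_coeff M p ps j h = 0"
  using assms unfolding le_nu_iff nonvanishing_at_def by (intro curve_coeff_eq_0) auto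

text \<open>The limit vanishes when \<open>m\<close> is smaller than \<open>\<nu>\<^sub>B(h)(p)\<close>; when \<open>m\<close> equals it, the limit is nonzero for
  suitable curves by the next lemma. These two facts express \<open>\<nu>\<^sub>B\<close> through orders of vanishing along curves.\<close>
lemma probes_jets_limit_nu:
  assumes "probes_jets M p ps c" "snd ` set ps \<subseteq> D_module M B" "smooth_germ M p h"
    and "enat m \<le> nu M B h p"
  shows "((\<lambda>\<tau>. h (c \<tau>) /\<^sub>R \<tau> ^ m) \<longlongrightarrow> curve_coeff M p ps m h) (at_right 0)"
  using probes_jets_limit[OF assms(1,3)] curve_coeff_below_nu[OF assms(2,4)] by blast

lemma exists_probing_curve_of_order_nu:
  assumes "real_hypersurface M" "smooth_subbundle M B s" "p \<in> M"
    and "nu M B f p = enat a" "nu M B g p = enat b"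
  shows "\<exists>ps c. probes_jets M p ps c \<and> snd ` set ps \<subseteq> D_module M B \<and>
    curve_coeff M p ps a f \<noteq> 0 \<and> curve_coeff M p ps b g \<noteq> 0"
proof -
  obtain Ys Zs where Ys: "length Ys = a" "set Ys \<subseteq> D_module M B" "fold (apply_field M) Ys f p \<noteq> 0"
    and Zs: "length Zs = b" "set Zs \<subseteq> D_module M B" "fold (apply_field M) Zs g p \<noteq> 0"
    using assms(4,5)[THEN nu_eq_imp_nonvanishing] unfolding nonvanishing_at_def by blast
  have "jet_nonzero M p (Ys @ Zs) a f" "jet_nonzero M p (Ys @ Zs) b g"
    using jet_nonzero_word[OF Ys(3), of Zs] jet_nonzero_append[OF jet_nonzero_word[OF Zs(3), of "[]"], of Ys] Ys(1) Zs(1)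
    by auto
  then obtain ps where ps: "map snd ps = Ys @ Zs" "curve_coeff M p ps a f \<noteq> 0" "curve_coeff M p ps b g \<noteq> 0"
    using exists_generic_times by blast
  have "snd ` set ps = set Ys \<union> set Zs" using arg_cong[OF ps(1), of set] by simp
  then have "snd ` set ps \<subseteq> D_module M B" using Ys(2) Zs(2) by simp
  moreover from this have "\<exists>c. probes_jets M p ps c"
    using D_module_tangent_field[OF assms(2)] by (intro probing_curve assms) blast
  ultimately show ?thesis using ps by blast
qed

text \<open>If \<open>f g\<close> had smaller order \<open>n\<close>, some curve would make \<open>f g / \<tau>\<^sup>n\<close> tend to a nonzero limit, while the bounded
  quotients \<open>f / \<tau>\<^sup>a\<close> and \<open>g / \<tau>\<^sup>b\<close> leave a positive power of \<open>\<tau>\<close> in it, which forces the limit to be zero.\<close>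
lemma nu_mult_ge:
  assumes M: "real_hypersurface M" "smooth_subbundle M B s" "p \<in> M"
    and f: "smooth_germ M p f" "enat a \<le> nu M B f p" and g: "smooth_germ M p g" "enat b \<le> nu M B g p"
  shows "enat (a + b) \<le> nu M B (\<lambda>z. f z * g z) p"
proof (rule ccontr)
  assume "\<not> ?thesis"
  then obtain n where n: "nu M B (\<lambda>z. f z * g z) p = enat n" "n < a + b"
    by (cases "nu M B (\<lambda>z. f z * g z) p") auto
  obtain ps c where c: "probes_jets M p ps c" "snd ` set ps \<subseteq> D_module M B"
    and nz: "curve_coeff M p ps n (\<lambda>z. f z * g z) \<noteq> 0"
    using exists_probing_curve_of_order_nu[OF M n(1) n(1)] by blast
  have fg: "((\<lambda>\<tau>. (f (c \<tau>) * g (c \<tau>)) /\<^sub>R \<tau> ^ n) \<longlongrightarrow> curve_coeff M p ps n (\<lambda>z. f z * g z)) (at_right 0)"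
    using probes_jets_limit_nu[OF c smooth_germ_mult[OF M(3) f(1) g(1)]] n(1) by simp
  have "((\<lambda>\<tau>. \<tau> ^ (a + b - n)) \<longlongrightarrow> 0) (at_right (0::real))"
    using n(2) by (auto intro!: tendsto_eq_intros)
  from tendsto_scaleR[OF this tendsto_mult[OF probes_jets_limit_nu[OF c f] probes_jets_limit_nu[OF c g]]]
  have "((\<lambda>\<tau>. \<tau> ^ (a + b - n) *\<^sub>R ((f (c \<tau>) /\<^sub>R \<tau> ^ a) * (g (c \<tau>) /\<^sub>R \<tau> ^ b))) \<longlongrightarrow> 0) (at_right 0)" by simp
  moreover have "\<forall>\<^sub>F \<tau> in at_right (0::real). \<tau> ^ (a + b - n) *\<^sub>R ((f (c \<tau>) /\<^sub>R \<tau> ^ a) * (g (c \<tau>) /\<^sub>R \<tau> ^ b)) =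
      (f (c \<tau>) * g (c \<tau>)) /\<^sub>R \<tau> ^ n"
    using eventually_at_right_less[of "0::real"]
  proof eventually_elim
    case (elim \<tau>)
    have "\<tau> ^ (a + b - n) * \<tau> ^ n = \<tau> ^ a * \<tau> ^ b"
      using n(2) by (simp flip: power_add)
    then have "\<tau> ^ (a + b - n) * (inverse (\<tau> ^ a) * inverse (\<tau> ^ b)) = inverse (\<tau> ^ n)"
      using elim by (simp add: field_simps)
    then show ?case by (simp add: mult_ac)
  qed
  ultimately have "((\<lambda>\<tau>. (f (c \<tau>) * g (c \<tau>)) /\<^sub>R \<tau> ^ n) \<longlongrightarrow> 0) (at_right 0)"
    by (rule Lim_transform_eventually)
  from tendsto_unique[OF _ fg this] nz show False by simp
qed

text \<open>For finite orders \<open>a\<close> and \<open>b\<close>, take one curve along which \<open>f / \<tau>\<^sup>a\<close> and \<open>g / \<tau>\<^sup>b\<close> both have nonzero limits. The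
  limit of \<open>f g / \<tau>\<^sup>a\<^sup>+\<^sup>b\<close> is their product, so the order of \<open>f g\<close> is not larger than \<open>a + b\<close>.\<close>
lemma nu_mult:
  assumes M: "real_hypersurface M" "smooth_subbundle M B s" "p \<in> M"
    and f: "smooth_germ M p f" and g: "smooth_germ M p g"
  shows "nu M B (\<lambda>z. f z * g z) p = nu M B f p + nu M B g p"
proof (cases "nu M B f p = \<infinity> \<or> nu M B g p = \<infinity>")
  case True
  have "enat k \<le> nu M B (\<lambda>z. f z * g z) p" for k
    using True nu_mult_ge[OF M f _ g, of k 0] nu_mult_ge[OF M f _ g, of 0 k]
    by (auto simp: zero_enat_def[symmetric])
  then have "nu M B (\<lambda>z. f z * g z) p = \<infinity>"
    by (metis enat_ord_simps(1) not_enat_eq not_less_eq_eq order_refl)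
  then show ?thesis using True by auto
next
  case False
  then obtain a b where a: "nu M B f p = enat a" and b: "nu M B g p = enat b" by auto
  obtain ps c where c: "probes_jets M p ps c" "snd ` set ps \<subseteq> D_module M B"
    and nz: "curve_coeff M p ps a f \<noteq> 0" "curve_coeff M p ps b g \<noteq> 0"
    using exists_probing_curve_of_order_nu[OF M a b] by blast
  have ge: "enat (a + b) \<le> nu M B (\<lambda>z. f z * g z) p"
    using nu_mult_ge[OF M f _ g] a b by simp
  have "((\<lambda>\<tau>. (f (c \<tau>) * g (c \<tau>)) /\<^sub>R \<tau> ^ (a + b)) \<longlongrightarrow> curve_coeff M p ps a f * curve_coeff M p ps b g) (at_right 0)"
    using tendsto_mult[OF probes_jets_limit_nu[OF c f, of a] probes_jets_limit_nu[OF c g, of b]] a b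
    by (simp add: power_add mult_ac)
  from tendsto_unique[OF _ probes_jets_limit_nu[OF c smooth_germ_mult[OF M(3) f g] ge] this]
  have "curve_coeff M p ps (a + b) (\<lambda>z. f z * g z) \<noteq> 0" using nz by simp
  then have "\<not> enat (Suc (a + b)) \<le> nu M B (\<lambda>z. f z * g z) p"
    using curve_coeff_below_nu[OF c(2)] by blast
  then show ?thesis using ge a b by (cases "nu M B (\<lambda>z. f z * g z) p") auto
qed

lemma eventually_along_probing_curve:
  assumes "probes_jets M p ps c" "\<forall>\<^sub>F z in nhds p. z \<in> M \<longrightarrow> P z"
  shows "\<forall>\<^sub>F \<tau> in at_right 0. 0 < \<tau> \<and> P (c \<tau>)"
proof -
  have "\<forall>\<^sub>F \<tau> in at_right 0. c \<tau> \<in> M \<longrightarrow> P (c \<tau>)" "\<forall>\<^sub>F \<tau> in at_right 0. c \<tau> \<in> M"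
    using assms eventually_compose_filterlim unfolding probes_jets_def by blast+
  with eventually_at_right_less[of "0::real"] show ?thesis by eventually_elim blast
qed

lemma curve_coeff_nonneg:
  assumes c: "probes_jets M p ps c" "snd ` set ps \<subseteq> D_module M B" "smooth_germ M p f"
    and m: "enat m \<le> nu M B f p"
    and nonneg: "\<forall>\<^sub>F z in nhds p. z \<in> M \<longrightarrow> f z \<in> \<real> \<and> 0 \<le> Re (f z)"
  shows "Im (curve_coeff M p ps m f) = 0" "0 \<le> Re (curve_coeff M p ps m f)"
proof -
  note lim = probes_jets_limit_nu[OF c m]
  note ev = eventually_along_probing_curve[OF c(1) nonneg]
  have "\<forall>\<^sub>F \<tau> in at_right 0. 0 = Im (f (c \<tau>) /\<^sub>R \<tau> ^ m)"
    using ev by eventually_elim (simp add: complex_is_Real_iff)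
  then have "((\<lambda>\<tau>. Im (f (c \<tau>) /\<^sub>R \<tau> ^ m)) \<longlongrightarrow> 0) (at_right 0)"
    by (rule Lim_transform_eventually[OF tendsto_const])
  from tendsto_unique[OF _ tendsto_Im[OF lim] this] show "Im (curve_coeff M p ps m f) = 0" by simp
  have "\<forall>\<^sub>F \<tau> in at_right 0. 0 \<le> Re (f (c \<tau>) /\<^sub>R \<tau> ^ m)"
    using ev by eventually_elim simp
  then show "0 \<le> Re (curve_coeff M p ps m f)"
    using tendsto_lowerbound[OF tendsto_Re[OF lim]] by simp
qed

text \<open>If \<open>f\<close> had the smaller order \<open>a\<close>, then along a suitable curve \<open>f / \<tau>\<^sup>a\<close> would tend to a nonzero limit and
  \<open>g / \<tau>\<^sup>a\<close> to zero, which squeezes the limit of \<open>f / \<tau>\<^sup>a\<close> to zero.\<close>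
lemma nu_antimono:
  assumes M: "real_hypersurface M" "smooth_subbundle M B s" "p \<in> M"
    and f: "smooth_germ M p f" and g: "smooth_germ M p g"
    and le: "\<forall>\<^sub>F z in nhds p. z \<in> M \<longrightarrow> f z \<in> \<real> \<and> 0 \<le> Re (f z) \<and> Re (f z) \<le> Re (g z)"
  shows "nu M B g p \<le> nu M B f p"
proof (rule ccontr)
  assume "\<not> ?thesis"
  then obtain a where a: "nu M B f p = enat a" and b: "enat (Suc a) \<le> nu M B g p"
    by (cases "nu M B f p") (auto simp: Suc_ile_eq not_le)
  obtain ps c where c: "probes_jets M p ps c" "snd ` set ps \<subseteq> D_module M B"
    and nz: "curve_coeff M p ps a f \<noteq> 0"
    using exists_probing_curve_of_order_nu[OF M a a] by blast
  have b': "enat a \<le> nu M B g p" using b by (meson enat_ord_simps(1) le_SucI order_refl order_trans)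
  have g0: "curve_coeff M p ps a g = 0"
    using curve_coeff_below_nu[OF c(2) b] by simp
  have "\<forall>\<^sub>F \<tau> in at_right 0. Re (f (c \<tau>) /\<^sub>R \<tau> ^ a) \<le> Re (g (c \<tau>) /\<^sub>R \<tau> ^ a)"
    using eventually_along_probing_curve[OF c(1) le] by eventually_elim simp
  with tendsto_le[OF _ tendsto_Re[OF probes_jets_limit_nu[OF c g b']] tendsto_Re[OF probes_jets_limit_nu[OF c f]]]
  have "Re (curve_coeff M p ps a f) \<le> 0" using g0 a by simp
  moreover have "\<forall>\<^sub>F z in nhds p. z \<in> M \<longrightarrow> f z \<in> \<real> \<and> 0 \<le> Re (f z)"
    using le by eventually_elim blast
  ultimately show False
    using curve_coeff_nonneg[OF c f _, of a] a nz by (simp add: complex_eq_iff)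
qed

text \<open>Reversing all times multiplies the leading coefficient by \<open>(-1)\<^sup>m\<close>. Since \<open>f\<close> is nonnegative along both
  curves, for odd \<open>m\<close> the coefficient would be nonnegative and nonpositive, hence zero.\<close>
lemma even_nu_of_nonneg:
  assumes M: "real_hypersurface M" "smooth_subbundle M B s" "p \<in> M"
    and f: "smooth_germ M p f" "\<forall>\<^sub>F z in nhds p. z \<in> M \<longrightarrow> f z \<in> \<real> \<and> 0 \<le> Re (f z)"
    and m: "nu M B f p = enat m"
  shows "even m"
proof (rule ccontr)
  assume odd: "odd m"
  obtain ps c where c: "probes_jets M p ps c" "snd ` set ps \<subseteq> D_module M B"
    and nz: "curve_coeff M p ps m f \<noteq> 0"
    using exists_probing_curve_of_order_nu[OF M m m] by blast
  define qs where "qs = map (\<lambda>(t, Z). (- t, Z)) ps"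
  have qs: "snd ` set qs \<subseteq> D_module M B" using c(2) by (auto simp: qs_def)
  then obtain d where d: "probes_jets M p qs d"
    using D_module_tangent_field[OF M(2)] probing_curve[OF M(1,3)] by blast
  have "curve_coeff M p qs m f = - curve_coeff M p ps m f"
    unfolding qs_def curve_coeff_reverse using odd by simp
  then have "Re (curve_coeff M p ps m f) = 0" "Im (curve_coeff M p ps m f) = 0"
    using curve_coeff_nonneg[OF c f(1) _ f(2), of m] curve_coeff_nonneg[OF d qs f(1) _ f(2), of m] m by auto
  then show False using nz by (simp add: complex_eq_iff)
qed

theorem theorem2p5:
  fixes M :: "(complex ^ 'n) set"
    and B :: "complex ^ 'n \<Rightarrow> (complex ^ 'n) set"
    and s :: nat
    and p :: "complex ^ 'n"
    and f g :: "complex ^ 'n \<Rightarrow> complex"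
  assumes "CARD('n) \<ge> 2"
    and "1 \<le> s" and "s \<le> CARD('n) - 1"
    and "real_hypersurface M"
    and "smooth_subbundle M B s"
    and "p \<in> M"
    and "smooth_germ M p f" and "smooth_germ M p g"
  shows "nu M B (\<lambda>z. f z * g z) p = nu M B f p + nu M B g p
    \<and> ((\<forall>\<^sub>F z in nhds p. z \<in> M \<longrightarrow>
            f z \<in> \<real> \<and> g z \<in> \<real> \<and> 0 \<le> Re (f z) \<and> Re (f z) \<le> Re (g z)) \<and> g p = f p
          \<longrightarrow> nu M B f p \<ge> nu M B g p)
    \<and> ((\<forall>\<^sub>F z in nhds p. z \<in> M \<longrightarrow> f z \<in> \<real> \<and> 0 \<le> Re (f z))
          \<longrightarrow> nu M B f p \<noteq> \<infinity> \<longrightarrow> (\<exists>k. nu M B f p = enat k \<and> even k))"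
proof (intro conjI impI)
  show "nu M B (\<lambda>z. f z * g z) p = nu M B f p + nu M B g p"
    using assms by (intro nu_mult)
next
  assume "(\<forall>\<^sub>F z in nhds p. z \<in> M \<longrightarrow>
      f z \<in> \<real> \<and> g z \<in> \<real> \<and> 0 \<le> Re (f z) \<and> Re (f z) \<le> Re (g z)) \<and> g p = f p"
  then have "\<forall>\<^sub>F z in nhds p. z \<in> M \<longrightarrow> f z \<in> \<real> \<and> 0 \<le> Re (f z) \<and> Re (f z) \<le> Re (g z)"
    by (auto elim: eventually_mono)
  then show "nu M B g p \<le> nu M B f p"
    using assms by (intro nu_antimono)
next
  assume "\<forall>\<^sub>F z in nhds p. z \<in> M \<longrightarrow> f z \<in> \<real> \<and> 0 \<le> Re (f z)" "nu M B f p \<noteq> \<infinity>"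
  then show "\<exists>k. nu M B f p = enat k \<and> even k"
    using even_nu_of_nonneg[OF assms(4-7)] by (cases "nu M B f p") auto
qed

end
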